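(* Let $\boldsymbol m,\boldsymbol l,k$ be consistent parameters. The space $V(\boldsymbol m,\boldsymbol l,k)$ has a basis of the form $$\{v_0(\boldsymbol m,\boldsymbol l,k),\ v_1(\boldsymbol m,\boldsymbol l,k)\,x^{m_1+1},\ \dots,\ v_r(\boldsymbol m,\boldsymbol l,k)\,x^{\sum_{i=1}^r m_i+r}\},$$ where $v_i(\boldsymbol m,\boldsymbol l,k)$ is a monic polynomial in $x$ of degree $k-l_i+l_{i+1}$ whose coefficients are (for fixed $\boldsymbol l,k$) rational functions of $\boldsymbol m$ with coefficients in $\mathbb Q$. Moreover, up to multiplication by a non-zero constant, $$v_i(\boldsymbol m,\boldsymbol l,k)=x^{-\sum_{j=1}^im_j-i}\ D_{\boldsymbol m,\boldsymbol l,k}\big(x^{\sum_{j=1}^im_j+i}\big),\qquad i=0,\dots,r.$$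
   Context: Fix an integer $r\ge1$. For $\boldsymbol m=(m_1,\dots,m_r)$, $\boldsymbol l=(l_1,\dots,l_r)$ and $k$ put $l_0=k$, $l_{r+1}=0$. The parameters are consistent if all $m_i,l_i,k$ are non-negative integers, $k\ge l_1\ge\dots\ge l_r\ge0$ and $l_s-l_{s+1}\le m_s$ for $s=1,\dots,r$. Put $e_i(\boldsymbol l,k)=k+\sum_{s=1}^im_s-l_i+l_{i+1}+i$, $i=0,\dots,r$. For consistent parameters, $V(\boldsymbol m,\boldsymbol l,k)$ is the unique $(r+1)$-dimensional complex vector space of polynomials in $x$ such that the set of degrees of its non-zero elements is $\{e_0<\dots<e_r\}$, the set of orders of vanishing at $x=0$ of its non-zero elements is $\{i+\sum_{s=1}^i m_s: i=0,\dots,r\}$, and the set of orders of vanishing at $x=1$ is $\{0,k+1,k+2,\dots,k+r\}$ (existence and uniqueness are known). $\boldsymbol 1_i=(1,\dots,1,0,\dots,0)\in\mathbb Z^r$ has $i$ ones. Put $D_i(\boldsymbol l,k)=x(x-1)\frac{d}{dx}-e_i(\boldsymbol l,k)(x-1)-k-1$, and $$D_{\boldsymbol m,\boldsymbol l,k}=D_{j(k)}\Big(\sum_{s=1}^{k-1}\boldsymbol 1_{j(s)},k-1\Big)\cdots D_{j(2)}(\boldsymbol 1_{j(1)},1)D_{j(1)}(\boldsymbol 0,0),$$ where $j(1),\dots,j(k)\in\{0,\dots,r\}$ is any sequence with $\sum_{s}\boldsymbol 1_{j(s)}=\boldsymbol l$ (so $i$ occurs $l_i-l_{i+1}$ times);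 the result does not depend on the order of the sequence because $D_j(\boldsymbol l+\boldsymbol 1_i,k+1)D_i(\boldsymbol l,k)=D_i(\boldsymbol l+\boldsymbol 1_j,k+1)D_j(\boldsymbol l,k)$. *)

theory Defs
  imports
    Complex_Main
    "HOL-Computational_Algebra.Computational_Algebra"
    "HOL-Library.Poly_Mapping"
begin

text \<open>
  The tuples \<open>m = (m\<^sub>1, \<dots>, m\<^sub>r)\<close> and \<open>l = (l\<^sub>1, \<dots>, l\<^sub>r)\<close> are functions \<open>nat \<Rightarrow> nat\<close> of which only
  the values at \<open>1, \<dots>, r\<close> are used.  The conventions \<open>l\<^sub>0 = k\<close> and \<open>l\<^bsub>r+1\<^esub> = 0\<close> are built into
  \<open>lext\<close>.
\<close>

definition lext :: "nat \<Rightarrow> (nat \<Rightarrow> nat) \<Rightarrow> nat \<Rightarrow> nat \<Rightarrow> nat" where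
  "lext r l k i = (if i = 0 then k else if i \<le> r then l i else 0)"

definition consistent :: "nat \<Rightarrow> (nat \<Rightarrow> nat) \<Rightarrow> (nat \<Rightarrow> nat) \<Rightarrow> nat \<Rightarrow> bool" where
  "consistent r m l k \<longleftrightarrow>
     (\<forall>i\<le>r. lext r l k (Suc i) \<le> lext r l k i) \<and>
     (\<forall>s\<in>{1..r}. int (lext r l k s) - int (lext r l k (Suc s)) \<le> int (m s))"

text \<open>\<open>expo0 m i\<close> is \<open>m\<^sub>1 + \<dots> + m\<^sub>i + i\<close>, the \<open>i\<close>-th exponent at \<open>0\<close>; \<open>expo_inf\<close> is
  \<open>e\<^sub>i(l, k)\<close>, the \<open>i\<close>-th degree.\<close>

definition expo0 :: "(nat \<Rightarrow> nat) \<Rightarrow> nat \<Rightarrow> nat" where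
  "expo0 m i = (\<Sum>s=1..i. m s) + i"

definition expo_inf :: "nat \<Rightarrow> (nat \<Rightarrow> nat) \<Rightarrow> (nat \<Rightarrow> nat) \<Rightarrow> nat \<Rightarrow> nat \<Rightarrow> int" where
  "expo_inf r m l k i =
     int k + (\<Sum>s=1..i. int (m s)) - int (lext r l k i) + int (lext r l k (Suc i)) + int i"

global_interpretation cpoly: vector_space "smult :: complex \<Rightarrow> complex poly \<Rightarrow> complex poly"
  by unfold_locales (simp_all add: smult_add_right smult_add_left)

text \<open>Since \<open>cpoly.dim\<close> is \<open>0\<close> on infinite-dimensional spaces, \<open>cpoly.dim V = r + 1\<close> includes
  finite-dimensionality.\<close>

definition has_exponents :: "nat \<Rightarrow> (nat \<Rightarrow> nat) \<Rightarrow> (nat \<Rightarrow> nat) \<Rightarrow> nat \<Rightarrow> complex poly set \<Rightarrow> bool" where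
  "has_exponents r m l k V \<longleftrightarrow>
     cpoly.subspace V \<and> cpoly.dim V = r + 1 \<and>
     (\<lambda>p. int (degree p)) ` (V - {0}) = expo_inf r m l k ` {0..r} \<and>
     order 0 ` (V - {0}) = expo0 m ` {0..r} \<and>
     order 1 ` (V - {0}) = {0} \<union> {k + 1..k + r}"

definition Vspace :: "nat \<Rightarrow> (nat \<Rightarrow> nat) \<Rightarrow> (nat \<Rightarrow> nat) \<Rightarrow> nat \<Rightarrow> complex poly set" where
  "Vspace r m l k = (THE V. has_exponents r m l k V)"

definition is_basis_family :: "nat \<Rightarrow> (nat \<Rightarrow> complex poly) \<Rightarrow> complex poly set \<Rightarrow> bool" where
  "is_basis_family r b V \<longleftrightarrow>
     inj_on b {0..r} \<and> cpoly.independent (b ` {0..r}) \<and> cpoly.span (b ` {0..r}) = V"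

definition ones :: "nat \<Rightarrow> nat \<Rightarrow> nat" where
  "ones i s = (if 1 \<le> s \<and> s \<le> i then 1 else 0)"

definition Dop :: "nat \<Rightarrow> (nat \<Rightarrow> nat) \<Rightarrow> nat \<Rightarrow> (nat \<Rightarrow> nat) \<Rightarrow> nat \<Rightarrow> complex poly \<Rightarrow> complex poly" where
  "Dop r m i l k p =
     [:0, 1:] * [:-1, 1:] * pderiv p
     - smult (of_int (expo_inf r m l k i)) ([:-1, 1:] * p)
     - smult (of_nat (k + 1)) p"

text \<open>\<open>Dcomp r m j n\<close> is the product of the first \<open>n\<close> operators attached to the sequence
  \<open>j 1, j 2, \<dots>\<close>, the operator for \<open>j 1\<close> being applied first.\<close>

fun Dcomp :: "nat \<Rightarrow> (nat \<Rightarrow> nat) \<Rightarrow> (nat \<Rightarrow> nat) \<Rightarrow> nat \<Rightarrow> complex poly \<Rightarrow> complex poly" where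
  "Dcomp r m j 0 p = p"
| "Dcomp r m j (Suc n) p = Dop r m (j (Suc n)) (\<lambda>s. \<Sum>t=1..n. ones (j t) s) n (Dcomp r m j n p)"

definition admissible_seq :: "nat \<Rightarrow> (nat \<Rightarrow> nat) \<Rightarrow> nat \<Rightarrow> (nat \<Rightarrow> nat) \<Rightarrow> bool" where
  "admissible_seq r l k j \<longleftrightarrow>
     (\<forall>t\<in>{1..k}. j t \<le> r) \<and> (\<forall>s\<in>{1..r}. (\<Sum>t=1..k. ones (j t) s) = l s)"

text \<open>Polynomials over the rationals in variables indexed by natural numbers have type
  \<open>(nat \<Rightarrow>\<^sub>0 nat) \<Rightarrow>\<^sub>0 rat\<close>: finitely supported coefficient functions on finitely supported
  exponent vectors.\<close>

definition mpoly_vars :: "((nat \<Rightarrow>\<^sub>0 nat) \<Rightarrow>\<^sub>0 rat) \<Rightarrow> nat set" where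
  "mpoly_vars P = (\<Union>t\<in>Poly_Mapping.keys P. Poly_Mapping.keys t)"

definition mpoly_eval :: "((nat \<Rightarrow>\<^sub>0 nat) \<Rightarrow>\<^sub>0 rat) \<Rightarrow> (nat \<Rightarrow> rat) \<Rightarrow> rat" where
  "mpoly_eval P x =
     (\<Sum>t\<in>Poly_Mapping.keys P. Poly_Mapping.lookup P t * (\<Prod>s\<in>Poly_Mapping.keys t. x s ^ Poly_Mapping.lookup t s))"

text \<open>On \<open>S\<close>, \<open>f\<close> is given by a rational function over the rationals in \<open>m\<^sub>1, \<dots>, m\<^sub>r\<close> whose
  denominator vanishes nowhere on \<open>S\<close>.\<close>

definition rational_function_on :: "nat \<Rightarrow> (nat \<Rightarrow> nat) set \<Rightarrow> ((nat \<Rightarrow> nat) \<Rightarrow> complex) \<Rightarrow> bool" where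
  "rational_function_on r S f \<longleftrightarrow>
     (\<exists>P Q. mpoly_vars P \<subseteq> {1..r} \<and> mpoly_vars Q \<subseteq> {1..r} \<and>
        (\<forall>m\<in>S. mpoly_eval Q (\<lambda>s. of_nat (m s)) \<noteq> 0 \<and>
           f m = of_rat (mpoly_eval P (\<lambda>s. of_nat (m s)) / mpoly_eval Q (\<lambda>s. of_nat (m s)))))"

end

theory Submission
  imports Defs
begin

text \<open>
  Write \<open>a\<^sub>i = m\<^sub>1 + \<dots> + m\<^sub>i + i\<close> for the exponents at \<open>0\<close> and \<open>n\<^sub>i = l\<^sub>i - l\<^bsub>i+1\<^esub>\<close>, so that
  \<open>k = n\<^sub>0 + \<dots> + n\<^sub>r\<close>, the \<open>i\<close>-th degree is \<open>a\<^sub>i + k - n\<^sub>i\<close>, and consistency says that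
  all \<open>n\<^sub>i\<close> are nonnegative and \<open>a\<^bsub>s-1\<^esub> + n\<^sub>s < a\<^sub>s\<close>.  Everything follows from one formula.  An operator \<open>D\<^sub>j\<close> sends
  \<open>(1 - x)\<^bsup>t+1\<^esup> F\<close> to \<open>-(1 - x)\<^bsup>t+2\<^esup> (x d/dx - \<rho>) F\<close> for a number \<open>\<rho>\<close>, that is, up to sign it
  multiplies the \<open>N\<close>-th coefficient of \<open>F\<close> by \<open>N - \<rho>\<close>.  Starting from
  \<open>x\<^bsup>a\<^esup> = (1 - x) \<Sum>\<^bsub>N\<ge>a\<^esub> x\<^bsup>N\<^esup>\<close>, the product of the operators turns \<open>x\<^bsup>a\<^esup>\<close>, \<open>a = a\<^sub>i\<close>, into
  \<open>(-1)\<^bsup>k\<^esup> u\<^sub>i\<close> with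
  \<open>u\<^sub>i = (1 - x)\<^bsup>k+1\<^esup> \<Sum>\<^bsub>N\<ge>a\<^esub> g(N) x\<^bsup>N\<^esup>\<close>, and the numbers \<open>\<rho>\<close> that occur are exactly those that make
  \<open>g(y) = \<Prod>\<^sub>s (y - a\<^sub>s + 1) \<cdots> (y - a\<^sub>s + n\<^sub>s)\<close>.  This is symmetric in the operators, so the order of the
  sequence is irrelevant.

  The roots \<open>a\<^sub>i - 1, \<dots>, a\<^sub>i - n\<^sub>i\<close> of \<open>g\<close> bring the degree of \<open>u\<^sub>i\<close> down from \<open>a\<^sub>i + k\<close> to
  \<open>a\<^sub>i + k - n\<^sub>i\<close>, and the top coefficient is \<open>\<plusminus>g(a\<^sub>i - n\<^sub>i - 1)\<close>, which is not zero
  (\<open>coeff_eulerian_top\<close>).  The coefficients are visibly rational in \<open>m\<close>.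

  It remains to see that the \<open>u\<^sub>i\<close> span the space with the prescribed exponents.  The exponents at
  \<open>0\<close> and the degrees are read off from the \<open>u\<^sub>i\<close>.  At \<open>1\<close> all \<open>u\<^sub>i\<close> have the value \<open>k!\<close>, and a
  combination that vanishes there is \<open>(1 - x)\<^bsup>k+1\<^esup> q\<close>, where \<open>q\<close> has coefficients \<open>C(N) g(N)\<close> with
  \<open>C\<close> constant on each of the \<open>r\<close> blocks \<open>a\<^sub>s \<le> N < a\<^bsub>s+1\<^esub>\<close>.  As \<open>g\<close> does not change sign
  inside a block, Descartes' argument bounds the order of \<open>q\<close> at \<open>1\<close> by \<open>r - 1\<close>
  (\<open>block_constant_signs_root_1\<close>).

  For uniqueness, count dimensions: a space with these exponents contains, for each \<open>i\<close>, some
  \<open>p\<^sub>i = x\<^bsup>a\<^esup> w\<close> (again \<open>a = a\<^sub>i\<close>) with \<open>deg w \<le> k - n\<^sub>i\<close> and \<open>p\<^sub>i(1) = 1\<close>.  The differences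
  \<open>d\<^sub>i = p\<^sub>i - u\<^sub>i/k!\<close> are congruent to each other modulo \<open>(x - 1)\<^bsup>k+1\<^esup>\<close> and vanish at \<open>1\<close>.  The
  polynomial \<open>G(y) = \<Sum>\<^sub>j c\<^sub>j (y - j + 1) \<cdots> (y - j + k)\<close>, where \<open>c\<^sub>j\<close> are the coefficients of
  \<open>d\<^sub>i\<close>, does not depend on \<open>i\<close>, has degree less than \<open>k\<close>, and vanishes at the \<open>k\<close> roots of \<open>g\<close>;
  so \<open>G = 0\<close>, which forces \<open>d\<^sub>i = 0\<close> (\<open>vanishing_family\<close>).
\<close>

section \<open>Moments of polynomials divisible by a power of $x-1$\<close>

text \<open>
  The functional \<open>\<Sum> p\<^sub>j x\<^sup>j \<mapsto> \<Sum> p\<^sub>j h(j)\<close>, that is, \<open>p \<mapsto> (h(x d/dx) p)(1)\<close>.  In this second form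
  it is clear that it only sees \<open>p\<close> modulo the power of \<open>x - 1\<close> with exponent \<open>deg h + 1\<close>.
\<close>
definition moment :: "complex poly \<Rightarrow> complex poly \<Rightarrow> complex" where
  "moment p h = (\<Sum>j\<le>degree p. coeff p j * poly h (of_nat j))"

lemma moment_eq_sum:
  assumes "\<And>j. n < j \<Longrightarrow> coeff p j = 0"
  shows "moment p h = (\<Sum>j\<le>n. coeff p j * poly h (of_nat j))"
proof -
  have "moment p h = (\<Sum>j\<le>max n (degree p). coeff p j * poly h (of_nat j))"
    unfolding moment_def by (rule sum.mono_neutral_left) (auto simp: coeff_eq_0)
  also have "\<dots> = (\<Sum>j\<le>n. coeff p j * poly h (of_nat j))"
    by (rule sum.mono_neutral_right) (auto simp: assms)
  finally show ?thesis .
qed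

lemma moment_diff: "moment (p - q) h = moment p h - moment q h"
proof -
  define n where "n = max (degree p) (degree q)"
  have "moment f h = (\<Sum>j\<le>n. coeff f j * poly h (of_nat j))" if "f \<in> {p, q, p - q}" for f
    using that by (intro moment_eq_sum) (auto simp: n_def coeff_eq_0)
  then show ?thesis by (simp add: sum_subtractf left_diff_distrib)
qed

lemma moment_pCons: "moment p (pCons c h) = c * poly p 1 + moment ([:0, 1:] * pderiv p) h"
proof -
  let ?d = "[:0, 1:] * pderiv p"
  have c: "coeff ?d j = of_nat j * coeff p j" for j
    by (cases j) (simp_all add: coeff_pderiv)
  have "moment ?d h = (\<Sum>j\<le>degree p. coeff ?d j * poly h (of_nat j))"
    by (rule moment_eq_sum) (metis c coeff_eq_0 mult_zero_right)
  then show ?thesis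
    unfolding c moment_def
    by (simp add: poly_altdef[of p] sum.distrib algebra_simps sum_distrib_left)
qed

lemma theta_dvd:
  fixes p :: "complex poly"
  assumes "[:-1, 1:] ^ Suc n dvd p"
  shows "[:-1, 1:] ^ n dvd [:0, 1:] * pderiv p"
proof -
  obtain q where q: "p = [:-1, 1:] ^ Suc n * q" using assms by (auto simp: dvd_def)
  have "pderiv p = [:-1, 1:] ^ n * (smult (of_nat (Suc n)) q + [:-1, 1:] * pderiv q)"
    unfolding q pderiv_mult pderiv_power_Suc
    by (simp add: pderiv_pCons algebra_simps)
  then show ?thesis by (metis dvd_mult dvd_triv_left)
qed

text \<open>
  By \<open>moment_pCons\<close>, a factor \<open>y\<close> of the test polynomial can be traded for an application of
  \<open>x d/dx\<close> to \<open>p\<close>; fewer than \<open>n\<close> of them leave a zero at \<open>1\<close>.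
\<close>
lemma moment_eq_0:
  assumes "[:-1, 1:] ^ n dvd p" "degree h < n"
  shows "moment p h = 0"
  using assms
proof (induction h arbitrary: p n)
  case 0
  then show ?case by (simp add: moment_def)
next
  case (pCons c h)
  then obtain n' where n: "n = Suc n'" by (cases n) auto
  have "poly p 1 = 0"
    using pCons.prems(1) by (auto simp: n dvd_def)
  moreover have "moment ([:0, 1:] * pderiv p) h = 0"
  proof (cases "h = 0")
    case False
    then show ?thesis
      using pCons.prems n by (intro pCons.IH theta_dvd) auto
  qed (simp add: moment_def)
  ultimately show ?case by (simp add: moment_pCons)
qed

section \<open>Generalised Eulerian polynomials\<close>

text \<open>
  For \<open>n\<close> roots equal to \<open>0\<close> this is the numerator of \<open>\<Sum>\<^sub>N N\<^sup>n x\<^sup>N\<close>, an Eulerian polynomial.  The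
  recursion is the differential operator on numerators that corresponds to \<open>x d/dx - s\<close> on
  generating functions; see \<open>fps_of_poly_eulerian\<close>.
\<close>
fun eulerian :: "complex list \<Rightarrow> complex poly" where
  "eulerian [] = 1"
| "eulerian (s # ss) = [:1, -1:] * ([:0, 1:] * pderiv (eulerian ss) - smult s (eulerian ss))
     + smult (of_nat (Suc (length ss))) ([:0, 1:] * eulerian ss)"

lemma poly_eulerian_1: "poly (eulerian ss) 1 = fact (length ss)"
  by (induction ss) auto

lemma fps_of_poly_eulerian:
  "fps_of_poly (eulerian ss) =
     (1 - fps_X) ^ Suc (length ss) * Abs_fps (\<lambda>N. \<Prod>s\<leftarrow>ss. of_nat N - s)"
proof (induction ss)
  case Nil
  show ?case
    by (rule fps_ext) (simp add: left_diff_distrib fps_X_mult_nth)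
next
  case (Cons s ss)
  define F where "F = Abs_fps (\<lambda>N. \<Prod>s\<leftarrow>ss. of_nat N - s)"
  have F: "Abs_fps (\<lambda>N. \<Prod>s\<leftarrow>s # ss. of_nat N - s) = fps_X * fps_deriv F - fps_const s * F"
    by (rule fps_ext) (simp add: F_def left_diff_distrib fps_X_mult_nth of_nat_diff)
  have X: "fps_of_poly [:1, -1:] = (1 - fps_X :: complex fps)"
    by (simp add: fps_of_poly_pCons)
  note IH = Cons[folded F_def]
  have d: "fps_of_poly (pderiv (eulerian ss)) =
      (1 - fps_X) ^ Suc (length ss) * fps_deriv F
        - fps_const (of_nat (Suc (length ss))) * (1 - fps_X) ^ length ss * F"
    unfolding fps_of_poly_pderiv IH fps_deriv_mult
    by (simp add: fps_deriv_power algebra_simps fps_of_nat del: of_nat_Suc power_Suc)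
  show ?case
    unfolding F eulerian.simps fps_of_poly_add fps_of_poly_diff fps_of_poly_mult fps_of_poly_smult
      X d fps_of_poly_fps_X IH
    by (simp add: algebra_simps del: of_nat_Suc)
qed

lemma coeff_eulerian:
  "coeff (eulerian ss) N =
     (\<Sum>j\<le>N. (-1) ^ j * of_nat (Suc (length ss) choose j) * (\<Prod>s\<leftarrow>ss. of_nat N - of_nat j - s))"
proof -
  have "(1 - fps_X :: complex fps) = fps_of_poly [:1, -1:]"
    by (simp add: fps_of_poly_pCons)
  then have "(1 - fps_X :: complex fps) ^ Suc (length ss) $ j = (-1) ^ j * of_nat (Suc (length ss) choose j)" for j
    unfolding \<open>1 - fps_X = _\<close>
    by (cases "j \<le> Suc (length ss)")
       (simp_all add: fps_of_poly_power[symmetric] coeff_linear_poly_power coeff_eq_0 degree_power_eq binomial_eq_0 del: power_Suc)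
  then have "coeff (eulerian ss) N = 
     (\<Sum>j=0..N. (-1) ^ j * of_nat (Suc (length ss) choose j) * (\<Prod>s\<leftarrow>ss. of_nat (N - j) - s))"
    unfolding fps_of_poly_nth[symmetric] fps_of_poly_eulerian fps_mult_nth by simp
  also have "\<dots> = (\<Sum>j\<le>N. (-1) ^ j * of_nat (Suc (length ss) choose j) * (\<Prod>s\<leftarrow>ss. of_nat N - of_nat j - s))"
    by (intro sum.cong) (auto simp: of_nat_diff)
  finally show ?thesis .
qed

lemma poly_prod_list_linear: "poly (\<Prod>s\<leftarrow>ss. [:c - s, d:]) (x :: complex) = (\<Prod>s\<leftarrow>ss. c + d * x - s)"
proof (induction ss)
  case (Cons s ss)
  have "poly [:c - s, d:] x = c + d * x - s" by (simp add: algebra_simps)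
  then show ?case using Cons by (simp only: list.map prod_list.Cons poly_mult)
qed simp

lemma degree_prod_list_linear_le: "degree (\<Prod>s\<leftarrow>ss. [:c - s, d:]) \<le> length ss"
proof (induction ss)
  case (Cons s ss)
  then show ?case
    using degree_mult_le[of "[:c - s, d:]" "\<Prod>s\<leftarrow>ss. [:c - s, d:]"] by (auto split: if_splits)
qed simp

text \<open>
  Let \<open>k\<close> be the number of roots.  If \<open>G\<close>, the product over the roots, vanishes at \<open>-1, \<dots>, -n\<close>, then the generating function of \<open>G\<close>
  may start at \<open>-n\<close> instead of \<open>0\<close> without being changed.  From the \<open>N\<close>-th coefficient on, where
  \<open>N = k + 1 - n\<close>, multiplication by \<open>(1 - x)\<^bsup>k+1\<^esup>\<close> is then a full difference of order \<open>k + 1\<close> of a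
  polynomial of degree \<open>k\<close>, hence zero; for \<open>N = k - n\<close> only the term \<open>G(-n - 1)\<close> is missing.
\<close>
lemma coeff_eulerian_top:
  fixes ss :: "complex list"
  defines "G \<equiv> \<lambda>y. \<Prod>s\<leftarrow>ss. y - s"
  assumes n: "n \<le> length ss" and zero: "\<And>t. t \<in> {1..n} \<Longrightarrow> G (- of_nat t) = 0"
    and N: "length ss \<le> N + n"
  shows "coeff (eulerian ss) N =
     (if N + n = length ss then (-1) ^ length ss * G (- of_nat (Suc n)) else 0)"
proof -
  define k where "k = length ss"
  define b :: "nat \<Rightarrow> complex" where "b j = (-1) ^ j * of_nat (Suc k choose j)" for j
  let ?P = "[:-1, 1:] ^ Suc k :: complex poly" and ?h = "\<Prod>s\<leftarrow>ss. [:of_nat N - s, -1:]"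
  have cP: "coeff ?P j = (-1) ^ Suc k * b j" for j
  proof (cases "j \<le> Suc k")
    case True
    then have "(-1::complex) ^ (Suc k - j) = (-1) ^ Suc k * (-1) ^ j"
      by (auto simp: minus_one_power_iff)
    then show ?thesis using True by (simp add: coeff_linear_poly_power b_def del: power_Suc)
  qed (simp add: coeff_eq_0 degree_linear_power b_def)
  have "(\<Sum>j\<le>N + Suc k. coeff ?P j * G (of_nat N - of_nat j)) = moment ?P ?h"
    by (subst moment_eq_sum[where n = "N + Suc k"])
       (auto simp: poly_prod_list_linear G_def cP b_def simp del: power_Suc intro!: sum.cong)
  also have "\<dots> = 0"
    using degree_prod_list_linear_le[of "of_nat N" "-1" ss]
    by (intro moment_eq_0[where n = "Suc k"]) (auto simp: k_def)
  finally have "0 = (-1) ^ Suc k * (\<Sum>j\<le>N + Suc k. b j * G (of_nat N - of_nat j))"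
    by (simp only: cP sum_distrib_left mult.assoc)
  then have "0 = (\<Sum>j\<le>N + Suc k. b j * G (of_nat N - of_nat j))" by simp
  also have "{..N + Suc k} = {..N} \<union> {N<..N + Suc k}" by auto
  also have "(\<Sum>j\<in>\<dots>. b j * G (of_nat N - of_nat j)) =
      coeff (eulerian ss) N + (\<Sum>j\<in>{N<..N + Suc k}. b j * G (of_nat N - of_nat j))"
    by (subst sum.union_disjoint) (auto simp: coeff_eulerian b_def G_def k_def)
  also have "(\<Sum>j\<in>{N<..N + Suc k}. b j * G (of_nat N - of_nat j)) =
      (\<Sum>j\<in>{N<..N + Suc k}. if j = Suc k then (if N + n = k then b (Suc k) * G (- of_nat (Suc n)) else 0) else 0)"
  proof (intro sum.cong refl)
    fix j assume j: "j \<in> {N<..N + Suc k}"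
    then have e: "of_nat N - of_nat j = (- of_nat (j - N) :: complex)" by (simp add: of_nat_diff)
    show "b j * G (of_nat N - of_nat j) =
      (if j = Suc k then (if N + n = k then b (Suc k) * G (- of_nat (Suc n)) else 0) else 0)"
    proof (cases "j = Suc k \<and> N + n = k")
      case True
      then have "j - N = Suc n" by auto
      then have "G (of_nat N - of_nat j) = G (- of_nat (Suc n))" unfolding e by (simp only:)
      then show ?thesis using True by simp
    next
      case False
      show ?thesis
      proof (cases "j \<le> Suc k")
        case True
        then have "j - N \<in> {1..n}" using False N j by (auto simp: k_def)
        then have "G (of_nat N - of_nat j) = 0" unfolding e by (rule zero)
        then show ?thesis using False by auto
      qed (auto simp: b_def)
    qed
  qed
  also have "\<dots> = (if N + n = k then b (Suc k) * G (- of_nat (Suc n)) else 0)"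
    using N n by (auto simp: k_def)
  finally show ?thesis by (auto simp: b_def k_def[symmetric] add_eq_0_iff)
qed

text \<open>The recursion depends on the order of the roots, its result only on their product.\<close>
lemma eulerian_cong:
  assumes "length ss = length ss'" "\<And>y. (\<Prod>s\<leftarrow>ss. y - s) = (\<Prod>s\<leftarrow>ss'. y - s)"
  shows "eulerian ss = eulerian ss'"
  by (simp only: fps_of_poly_eq_iff[symmetric] fps_of_poly_eulerian assms)

section \<open>A Descartes bound for the order at 1\<close>

text \<open>
  A test polynomial for Descartes' rule: it takes prescribed signs on consecutive blocks of integers,
  one root halfway before each new block where the sign has to change.
\<close>
lemma sign_pattern_poly:
  fixes \<sigma> :: "nat \<Rightarrow> real" and b :: "nat \<Rightarrow> nat"
  assumes "\<And>s. s \<le> R \<Longrightarrow> \<sigma> s \<noteq> 0" "\<And>s. s < R \<Longrightarrow> b s \<le> b (Suc s)"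
  shows "\<exists>h :: real poly. degree h \<le> R \<and>
    (\<forall>s N. s \<le> R \<and> b s \<le> N \<and> (s < R \<longrightarrow> N < b (Suc s)) \<longrightarrow> \<sigma> s * poly h (of_nat N) > 0)"
  using assms
proof (induction R)
  case 0
  then show ?case by (intro exI[of _ "[:\<sigma> 0:]"]) (auto simp: zero_less_mult_iff)
next
  case (Suc R)
  then obtain h where h: "degree h \<le> R"
    "\<And>s N. s \<le> R \<Longrightarrow> b s \<le> N \<Longrightarrow> (s < R \<Longrightarrow> N < b (Suc s)) \<Longrightarrow> \<sigma> s * poly h (of_nat N) > 0"
    by (metis less_Suc_eq le_Suc_eq)
  have mono: "b (Suc s) \<le> b (Suc R)" if "s \<le> R" for s
    using that Suc.prems(2) by (induction rule: inc_induct) (auto intro: order_trans)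
  have bR: "b R \<le> b (Suc R)" using Suc.prems(2) by simp
  have ne: "\<sigma> (Suc R) \<noteq> 0" "\<sigma> R \<noteq> 0" using Suc.prems(1) by auto
  show ?case
  proof (cases "\<sigma> R * \<sigma> (Suc R) > 0")
    case True
    have "\<sigma> s * poly h (of_nat N) > 0"
      if "s \<le> Suc R" "b s \<le> N" "s < Suc R \<longrightarrow> N < b (Suc s)" for s N
    proof (cases "s = Suc R")
      case eq: True
      have "\<sigma> R * poly h (of_nat N) > 0" using that bR eq by (intro h(2)) auto
      then show ?thesis using True eq by (auto simp: zero_less_mult_iff)
    qed (use that h(2) in auto)
    then show ?thesis using h(1) by (intro exI[of _ h]) auto
  next
    case False
    then have neg: "\<sigma> R * \<sigma> (Suc R) < 0" using ne by (meson linorder_neqE_linordered_idom mult_eq_0_iff)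
    \<comment> \<open>The half-integer root lies strictly between the last two blocks, so no value on an integer vanishes.\<close>
    define h' where "h' = [:of_nat (b (Suc R)) - 1 / 2, -1:] * h"
    have ph: "poly h' (of_nat N) = (of_nat (b (Suc R)) - 1 / 2 - of_nat N) * poly h (of_nat N)" for N
      by (simp add: h'_def algebra_simps)
    have "degree h' \<le> Suc R"
      using degree_mult_le[of "[:of_nat (b (Suc R)) - 1 / 2, -1:]" h] h(1) by (simp add: h'_def)
    moreover have "\<sigma> s * poly h' (of_nat N) > 0"
      if "s \<le> Suc R" "b s \<le> N" "s < Suc R \<longrightarrow> N < b (Suc s)" for s N
    proof (cases "s = Suc R")
      case eq: True
      have "\<sigma> R * poly h (of_nat N) > 0" using that bR eq by (intro h(2)) auto
      then have "\<sigma> s * poly h (of_nat N) < 0"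
        using neg eq by (auto simp: zero_less_mult_iff mult_less_0_iff)
      moreover have "of_nat (b (Suc R)) - 1 / 2 - of_nat N < (0::real)" using that eq by auto
      ultimately show ?thesis unfolding ph by (auto simp: zero_less_mult_iff mult_less_0_iff)
    next
      case neq: False
      then have "\<sigma> s * poly h (of_nat N) > 0" using that by (intro h(2)) auto
      moreover have "N < b (Suc R)" using that neq mono[of s] by auto
      then have "of_nat (b (Suc R)) - 1 / 2 - of_nat N > (0::real)" by linarith
      ultimately show ?thesis unfolding ph by (auto simp: zero_less_mult_iff mult_less_0_iff)
    qed
    ultimately show ?thesis by (intro exI[of _ h']) auto
  qed
qed

lemma poly_map_of_real: "poly (map_poly of_real h) (of_real x) = (of_real (poly h x) :: complex)"
  by (induction h) (simp_all add: map_poly_pCons)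

text \<open>
  Descartes' rule at the point \<open>1\<close>: on \<open>r\<close> blocks of constant sign there are at most \<open>r - 1\<close> sign
  changes, so a zero of order \<open>r\<close> is impossible.  Pairing the coefficients with a test polynomial of
  the same sign pattern gives a vanishing sum of nonnegative terms.  The weights \<open>w\<close> are real, so
  the real and the imaginary parts of the block constants can be treated separately.
\<close>
lemma block_constant_signs_root_1:
  fixes q :: "complex poly" and \<gamma> :: "nat \<Rightarrow> complex"
  assumes mono: "\<And>s. s < r \<Longrightarrow> b s \<le> b (Suc s)"
    and blk: "\<And>s N. s < r \<Longrightarrow> b s \<le> N \<Longrightarrow> N < b (Suc s) \<Longrightarrow> coeff q N = \<gamma> s * of_real (w N) \<and> 0 \<le> w N"
    and out: "\<And>N. N < b 0 \<or> b r \<le> N \<Longrightarrow> coeff q N = 0"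
    and dvd: "[:-1, 1:] ^ r dvd q"
  shows "q = 0"
proof -
  have in_block: "\<exists>s<r. b s \<le> N \<and> N < b (Suc s)" if "coeff q N \<noteq> 0" for N
  proof -
    have N: "b 0 \<le> N" "N < b r" using out[of N] that by (meson not_le)+
    define s where "s = (LEAST s. N < b (Suc s))"
    have r0: "0 < r" using N by (cases r) auto
    then have ex: "N < b (Suc (r - 1))" using N by simp
    then have 1: "N < b (Suc s)" unfolding s_def by (rule LeastI)
    have "s \<le> r - 1" unfolding s_def using ex by (rule Least_le)
    moreover have "b s \<le> N"
    proof (cases s)
      case (Suc s')
      then show ?thesis using not_less_Least[of s' "\<lambda>s. N < b (Suc s)"] by (auto simp: s_def)
    qed (use N in simp)
    ultimately show ?thesis using 1 r0 by (intro exI[of _ s]) auto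
  qed
  have key: "f (coeff q N) = 0"
    if lin: "\<And>z x. f (z * of_real x) = f z * x" "\<And>S g. f (sum g S) = (\<Sum>j\<in>(S::nat set). f (g j))" and f0: "f 0 = (0::real)"
    for f N
  proof (cases "r = 0")
    case True
    then have "coeff q N = 0" using in_block[of N] by auto
    then show ?thesis using f0 by simp
  next
    case False
    \<comment> \<open>The linear form \<open>f\<close> is \<open>Re\<close> or \<open>Im\<close>.\<close>
    define \<sigma> :: "nat \<Rightarrow> real" where "\<sigma> s = (if f (\<gamma> s) \<ge> 0 then 1 else -1)" for s
    obtain h :: "real poly" where h: "degree h \<le> r - 1"
      "\<And>s N. s \<le> r - 1 \<Longrightarrow> b s \<le> N \<Longrightarrow> (s < r - 1 \<longrightarrow> N < b (Suc s)) \<Longrightarrow> \<sigma> s * poly h (of_nat N) > 0"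
    proof -
      have "\<And>s. s \<le> r - 1 \<Longrightarrow> \<sigma> s \<noteq> 0" by (simp add: \<sigma>_def)
      moreover have "\<And>s. s < r - 1 \<Longrightarrow> b s \<le> b (Suc s)" using mono by simp
      ultimately show thesis using sign_pattern_poly[of "r - 1" \<sigma> b] that by blast
    qed
    have hs: "\<sigma> s * poly h (of_nat j) > 0" if "s < r" "b s \<le> j" "j < b (Suc s)" for s j
      using h(2)[of s j] that by auto
    have nn: "0 \<le> f (coeff q j) * poly h (of_nat j)" for j
    proof (cases "coeff q j = 0")
      case nz: False
      then obtain s where s: "s < r" "b s \<le> j" "j < b (Suc s)" using in_block by blast
      have "f (coeff q j) = f (\<gamma> s) * w j" "0 \<le> w j" using blk[OF s] lin(1) by auto
      then show ?thesis using hs[OF s]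
        by (auto simp: \<sigma>_def zero_le_mult_iff mult_le_0_iff split: if_splits)
    qed (simp add: f0)
    have "moment q (map_poly of_real h) = 0"
      using h(1) False by (intro moment_eq_0[OF dvd]) (simp add: degree_map_poly)
    then have "0 = f (\<Sum>j\<le>degree q. coeff q j * of_real (poly h (of_nat j)))"
      using poly_map_of_real[of h "of_nat _"] by (simp add: moment_def f0)
    also have "\<dots> = (\<Sum>j\<le>degree q. f (coeff q j) * poly h (of_nat j))"
      by (simp add: lin)
    finally have z: "f (coeff q j) * poly h (of_nat j) = 0" if "j \<le> degree q" for j
      using that nn by (metis (no_types, lifting) sum_nonneg_eq_0_iff finite_atMost atMost_iff)
    show ?thesis
    proof (cases "coeff q N = 0")
      case nz: False
      then obtain s where s: "s < r" "b s \<le> N" "N < b (Suc s)" using in_block by blast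
      then show ?thesis using z[OF le_degree[OF nz]] hs[OF s] by auto
    qed (simp add: f0)
  qed
  have "coeff q N = 0" for N
    using key[of Re N] key[of Im N] by (simp add: complex_eq_iff)
  then show ?thesis by (simp add: poly_eq_iff)
qed

section \<open>Linear algebra with orders and degrees\<close>

text \<open>
  Elements that realise the finitely many orders span: subtracting a multiple of the one with the
  same order raises the order of any given element.
\<close>
lemma dim_le_card_orders:
  assumes V: "cpoly.subspace V" and fin: "finite (order c ` (V - {0}))"
  shows "cpoly.dim V \<le> card (order c ` (V - {0}))"
proof -
  define O' where "O' = order c ` (V - {0})"
  define z where "z o' = (SOME v. v \<in> V - {0} \<and> order c v = o')" for o'
  have z: "z o' \<in> V - {0} \<and> order c (z o') = o'" if "o' \<in> O'" for o'
    unfolding z_def by (rule someI_ex) (use that in \<open>auto simp: O'_def\<close>)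
  have "v \<in> cpoly.span (z ` O')" if "v \<in> V" for v
    using that
  proof (induction "Max O' - order c v" arbitrary: v rule: less_induct)
    case less
    show ?case
    proof (cases "v = 0")
      case True
      then show ?thesis by (simp add: cpoly.span_zero)
    next
      case False
      define o' where "o' = order c v"
      have o: "o' \<in> O'" using less.prems False by (auto simp: o'_def O'_def)
      obtain v' where v': "v = [:-c, 1:] ^ o' * v'" using order_1[of c v] by (auto simp: o'_def dvd_def)
      obtain y where y: "z o' = [:-c, 1:] ^ o' * y" "\<not> [:-c, 1:] dvd y"
        using order_decomp[of "z o'" c] z[OF o] by auto
      define \<mu> where "\<mu> = poly v' c / poly y c"
      define d where "d = v - smult \<mu> (z o')"
      have dV: "d \<in> V"
        unfolding d_def using z[OF o] less.prems V by (intro cpoly.subspace_diff cpoly.subspace_scale) auto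
      have "poly (v' - smult \<mu> y) c = 0"
        using y(2) by (simp add: \<mu>_def poly_eq_0_iff_dvd)
      then have "[:-c, 1:] dvd v' - smult \<mu> y" by (simp only: poly_eq_0_iff_dvd)
      then have "[:-c, 1:] ^ o' * [:-c, 1:] dvd [:-c, 1:] ^ o' * (v' - smult \<mu> y)"
        by (rule mult_dvd_mono[OF dvd_refl])
      then have "[:-c, 1:] ^ Suc o' dvd d"
        by (simp only: d_def v' y(1) power_Suc2 right_diff_distrib mult_smult_right)
      then have "d = 0 \<or> Suc o' \<le> order c d" by (simp only: order_divides)
      then have "d \<in> cpoly.span (z ` O')"
      proof
        assume s: "Suc o' \<le> order c d"
        show ?thesis
        proof (cases "d = 0")
          case nz: False
          then have "order c d \<in> O'" using dV by (auto simp: O'_def)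
          then have "order c d \<le> Max O'" using fin by (auto simp: O'_def)
          then show ?thesis using s by (intro less.hyps dV) (auto simp: o'_def)
        qed (simp add: cpoly.span_zero)
      qed (simp add: cpoly.span_zero)
      then have "d + smult \<mu> (z o') \<in> cpoly.span (z ` O')"
        using o by (rule_tac cpoly.span_add[OF _ cpoly.span_scale[OF cpoly.span_base]]) auto
      then show ?thesis by (simp add: d_def)
    qed
  qed
  then have "cpoly.dim V \<le> card (z ` O')"
    using z fin by (intro cpoly.span_card_ge_dim) (auto simp: O'_def)
  also have "\<dots> \<le> card O'" using fin by (auto intro: card_image_le simp: O'_def)
  finally show ?thesis by (simp add: O'_def)
qed

lemma independent_family:
  assumes "\<And>c. (\<Sum>i\<le>R. smult (c i) (u i)) = 0 \<Longrightarrow> \<forall>i\<le>(R::nat). c i = 0"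
  shows "inj_on u {..R}" "cpoly.independent (u ` {..R})"
proof -
  show inj: "inj_on u {..R}"
  proof (rule inj_onI, rule ccontr)
    fix i j assume ij: "i \<in> {..R}" "j \<in> {..R}" "u i = u j" "i \<noteq> j"
    let ?c = "\<lambda>s. (if s = i then 1 else 0) - (if s = j then 1 else 0) :: complex"
    have "(\<Sum>s\<le>R. smult (?c s) (u s)) =
        (\<Sum>s\<le>R. (if s = i then u s else 0) - (if s = j then u s else 0))"
      by (intro sum.cong) auto
    also have "\<dots> = 0" using ij by (simp add: sum_subtractf)
    finally show False using assms[of ?c] ij by auto
  qed
  show "cpoly.independent (u ` {..R})"
  proof (rule cpoly.independent_if_scalars_zero)
    fix f x assume f: "(\<Sum>x\<in>u ` {..R}. smult (f x) x) = 0" and x: "x \<in> u ` {..R}"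
    have "(\<Sum>i\<le>R. smult (f (u i)) (u i)) = 0"
      using f by (simp add: sum.reindex[OF inj])
    then show "f x = 0" using assms[of "\<lambda>i. f (u i)"] x by auto
  qed simp
qed

lemma span_family:
  assumes "inj_on u {..R}" "w \<in> cpoly.span (u ` {..R::nat})"
  obtains c where "w = (\<Sum>i\<le>R. smult (c i) (u i))"
proof -
  obtain f where "w = (\<Sum>x\<in>u ` {..R}. smult (f x) x)"
    using assms(2) by (auto simp: cpoly.span_finite)
  then have "w = (\<Sum>i\<le>R. smult (f (u i)) (u i))" by (simp add: sum.reindex[OF assms(1)])
  then show ?thesis by (rule that)
qed

lemma lincomb_top_degree:
  fixes u :: "nat \<Rightarrow> complex poly"
  assumes "\<And>i j. i < j \<Longrightarrow> j \<le> R \<Longrightarrow> degree (u i) < degree (u j)" "\<And>i. i \<le> R \<Longrightarrow> u i \<noteq> 0"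
    and "i0 \<le> R" "c i0 \<noteq> 0"
  shows "\<exists>i\<le>R. (\<Sum>i\<le>R. smult (c i) (u i)) \<noteq> 0 \<and> degree (\<Sum>i\<le>R. smult (c i) (u i)) = degree (u i)"
proof -
  define I where "I = {i. i \<le> R \<and> c i \<noteq> 0}"
  define M where "M = Max I"
  have I: "finite I" "I \<noteq> {}" using assms(3,4) by (auto simp: I_def)
  then have "M \<in> I" unfolding M_def by (rule Max_in)
  then have M: "M \<le> R" "c M \<noteq> 0" by (auto simp: I_def)
  have z: "c i = 0" if "i \<le> R" "M < i" for i
    using that I(1) Max_ge[of I i] unfolding M_def by (auto simp: I_def simp flip: not_le)
  let ?w = "\<Sum>i\<le>R. smult (c i) (u i)"
  have small: "coeff (smult (c i) (u i)) N = 0"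
    if "i \<le> R" "degree (u M) < N \<or> degree (u M) \<le> N \<and> i \<noteq> M" for i N
  proof (cases i M rule: linorder_cases)
    case less
    then have "degree (u i) < N" using assms(1)[of i M] M that by auto
    then show ?thesis by (simp add: coeff_eq_0)
  qed (use that z in \<open>auto simp: coeff_eq_0\<close>)
  have "coeff ?w (degree (u M)) = (\<Sum>i\<le>R. if i = M then c M * lead_coeff (u M) else 0)"
    unfolding coeff_sum by (intro sum.cong) (use small in auto)
  then have nz: "coeff ?w (degree (u M)) \<noteq> 0" using M assms(2) by simp
  have "coeff ?w N = 0" if "degree (u M) < N" for N
    unfolding coeff_sum using that by (intro sum.neutral ballI small) auto
  then have "degree ?w = degree (u M)"
    using nz by (intro antisym degree_le le_degree) auto
  then show ?thesis using M nz by (intro exI[of _ M]) auto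
qed

lemma order_0_eqI:
  fixes p :: "complex poly"
  assumes "coeff p n \<noteq> 0" "\<And>i. i < n \<Longrightarrow> coeff p i = 0"
  shows "order 0 p = n"
proof -
  have p: "p \<noteq> 0" using assms(1) by auto
  have "n \<le> order 0 p" using assms p by (metis monom_1_dvd_iff monom_1_dvd_iff')
  moreover have "\<not> Suc n \<le> order 0 p" using assms p by (metis monom_1_dvd_iff monom_1_dvd_iff' lessI)
  ultimately show ?thesis by simp
qed

lemma lincomb_order_0:
  fixes u :: "nat \<Rightarrow> complex poly"
  assumes "\<And>i j. i < j \<Longrightarrow> j \<le> R \<Longrightarrow> a i < a j"
    and u: "\<And>i. i \<le> R \<Longrightarrow> coeff (u i) (a i) \<noteq> 0" "\<And>i N. i \<le> R \<Longrightarrow> N < a i \<Longrightarrow> coeff (u i) N = 0"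
    and "i0 \<le> R" "c i0 \<noteq> 0"
  shows "\<exists>i\<le>R. order 0 (\<Sum>i\<le>R. smult (c i) (u i)) = a i"
proof -
  define M where "M = (LEAST i. i \<le> R \<and> c i \<noteq> 0)"
  have M: "M \<le> R" "c M \<noteq> 0" using LeastI[of "\<lambda>i. i \<le> R \<and> c i \<noteq> 0" i0] assms(4,5) by (auto simp: M_def)
  have z: "c i = 0" if "i \<le> R" "i < M" for i
    using that not_less_Least[of i "\<lambda>i. i \<le> R \<and> c i \<noteq> 0"] by (auto simp: M_def)
  let ?w = "\<Sum>i\<le>R. smult (c i) (u i)"
  have small: "coeff (smult (c i) (u i)) N = 0"
    if "i \<le> R" "N < a M \<or> N \<le> a M \<and> i \<noteq> M" for i N
  proof (cases i M rule: linorder_cases)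
    case greater
    then show ?thesis using assms(1)[of M i] u(2)[of i N] that by auto
  qed (use that z u(2) in auto)
  have "coeff ?w (a M) = (\<Sum>i\<le>R. if i = M then c M * coeff (u M) (a M) else 0)"
    unfolding coeff_sum by (intro sum.cong) (use small in auto)
  then have nz: "coeff ?w (a M) \<noteq> 0" using M u by simp
  have "coeff ?w N = 0" if "N < a M" for N
    unfolding coeff_sum using that by (intro sum.neutral ballI small) auto
  then show ?thesis using M nz by (intro exI[of _ M] conjI order_0_eqI)
qed

section \<open>The space spanned by the Eulerian polynomials\<close>

text \<open>
  This retains of consistent parameters only what the construction uses: the exponents \<open>a\<^sub>i\<close> at \<open>0\<close>
  and the numbers \<open>n\<^sub>i = l\<^sub>i - l\<^bsub>i+1\<^esub>\<close>.  The integers \<open>a\<^sub>s - n\<^sub>s, \<dots>, a\<^sub>s - 1\<close> fit into the gap between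
  \<open>a\<^bsub>s-1\<^esub>\<close> and \<open>a\<^sub>s\<close>.
\<close>
locale exponent_data =
  fixes r k :: nat and a n :: "nat \<Rightarrow> nat"
  assumes gap: "s < r \<Longrightarrow> a s + n (Suc s) < a (Suc s)"
    and sum_n: "k = (\<Sum>s\<le>r. n s)"
begin

lemma gap_less:
  assumes "i < j" "j \<le> r"
  shows "a i + n j < a j"
  using assms(1,2)
proof (induction rule: strict_inc_induct)
  case (base i)
  then show ?case using gap[of i] by auto
next
  case (step i)
  then show ?case using gap[of i] by auto
qed

lemma a_mono: "i \<le> j \<Longrightarrow> j \<le> r \<Longrightarrow> a i \<le> a j"
  using gap_less[of i j] by (cases "i = j") auto

lemma n_le: "i \<le> r \<Longrightarrow> n i \<le> k"
  unfolding sum_n by (rule member_le_sum) auto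

text \<open>
  The coefficient function \<open>g\<close> of the generating functions.  It is polymorphic because its signs are
  studied over the integers and its values are used over the complex numbers.
\<close>
definition coeff_fun :: "'b :: idom \<Rightarrow> 'b" where
  "coeff_fun y = (\<Prod>s\<le>r. \<Prod>t=1..n s. y - of_nat (a s) + of_nat t)"

lemma coeff_fun_eq_0_iff: "coeff_fun y = 0 \<longleftrightarrow> (\<exists>s\<le>r. \<exists>t\<in>{1..n s}. y - of_nat (a s) + of_nat t = 0)"
  by (auto simp: coeff_fun_def)

lemma coeff_fun_of_int: "coeff_fun (of_int z :: 'b :: idom) = of_int (coeff_fun z)"
  by (simp add: coeff_fun_def)

text \<open>
  These two integers enclose the roots \<open>a\<^sub>i - n\<^sub>i, \<dots>, a\<^sub>i - 1\<close>, and the gaps keep the roots that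
  belong to other exponents away from them.  They give the lowest and the top coefficient of \<open>u\<^sub>i\<close>.
\<close>
lemma coeff_fun_int_nonzero:
  assumes "i \<le> r" "z = int (a i) \<or> z = int (a i) - int (n i) - 1"
  shows "coeff_fun z \<noteq> 0"
proof
  assume "coeff_fun z = 0"
  then obtain s t where s: "s \<le> r" "1 \<le> t" "t \<le> n s" "z - int (a s) + int t = 0"
    by (auto simp: coeff_fun_eq_0_iff)
  then show False
    using assms gap_less[of i s] gap_less[of s i] by (cases s i rule: linorder_cases) auto
qed

text \<open>The roots of \<open>g\<close>, translated so that \<open>a\<^sub>i\<close> becomes the origin.\<close>
definition shifted_roots :: "nat \<Rightarrow> complex list" where
  "shifted_roots i =
     concat (map (\<lambda>s. map (\<lambda>t. of_nat (a s) - of_nat t - of_nat (a i)) [1..<Suc (n s)]) [0..<Suc r])"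

lemma prod_shifted_roots: "(\<Prod>\<rho>\<leftarrow>shifted_roots i. y - \<rho>) = coeff_fun (y + of_nat (a i))"
proof -
  have row: "(\<Prod>t\<leftarrow>[1..<Suc m]. f t) = (\<Prod>t=1..m. f t)" for f :: "nat \<Rightarrow> complex" and m
    by (subst prod.distinct_set_conv_list[symmetric]) (auto intro!: prod.cong)
  have cat: "(\<Prod>x\<leftarrow>concat (map F [0..<Suc R]). h x) = (\<Prod>s\<le>R. \<Prod>x\<leftarrow>F s. h x)"
    for F :: "nat \<Rightarrow> complex list" and h :: "complex \<Rightarrow> complex" and R
    by (induction R) (simp_all add: mult.commute)
  show ?thesis
    unfolding shifted_roots_def coeff_fun_def cat map_map comp_def row
    by (simp add: algebra_simps)
qed

lemma length_shifted_roots: "length (shifted_roots i) = k"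
proof -
  have "length (concat (map (\<lambda>s. map (\<lambda>t. f s t) [1..<Suc (n s)]) [0..<Suc R])) = (\<Sum>s\<le>R. n s)"
    for R and f :: "nat \<Rightarrow> nat \<Rightarrow> complex"
    by (induction R) auto
  then show ?thesis unfolding shifted_roots_def sum_n .
qed

definition u :: "nat \<Rightarrow> complex poly" where
  "u i = monom 1 (a i) * eulerian (shifted_roots i)"

lemma coeff_u: "coeff (u i) N = (if N < a i then 0 else coeff (eulerian (shifted_roots i)) (N - a i))"
  by (simp add: u_def coeff_monom_mult)

text \<open>
  After multiplication by \<open>x\<close> to the power \<open>a\<^sub>i\<close> the translation of the roots disappears: the series
  \<open>u\<^sub>i / (1 - x)\<^bsup>k+1\<^esup>\<close> are truncations of one and the same series, at different starting points.
\<close>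
lemma fps_of_poly_u:
  "fps_of_poly (u i) = (1 - fps_X) ^ Suc k * Abs_fps (\<lambda>N. if N < a i then 0 else coeff_fun (of_nat N))"
proof -
  have "fps_X ^ a i * Abs_fps (\<lambda>N. \<Prod>\<rho>\<leftarrow>shifted_roots i. of_nat N - \<rho>) =
      Abs_fps (\<lambda>N. if N < a i then 0 else coeff_fun (of_nat N))"
    by (rule fps_ext) (simp add: fps_X_power_mult_nth prod_shifted_roots of_nat_diff)
  then show ?thesis
    unfolding u_def fps_of_poly_mult fps_of_poly_monom' fps_of_poly_eulerian length_shifted_roots
    by (simp only: mult.left_commute[of "fps_X ^ a i"])
qed

lemma poly_u_1: "poly (u i) 1 = fact k"
  by (simp add: u_def poly_monom poly_eulerian_1 length_shifted_roots)

lemma coeff_eulerian_shifted_top: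
  assumes "i \<le> r" "k \<le> N + n i"
  shows "coeff (eulerian (shifted_roots i)) N =
     (if N + n i = k then (-1) ^ k * of_int (coeff_fun (int (a i) - int (n i) - 1)) else 0)"
proof -
  have z: "(\<Prod>\<rho>\<leftarrow>shifted_roots i. - of_nat t - \<rho>) = 0" if "t \<in> {1..n i}" for t
    unfolding prod_shifted_roots coeff_fun_eq_0_iff using that assms(1) by (intro exI[of _ i]) auto
  have "coeff_fun (- of_nat (Suc (n i)) + of_nat (a i)) = (of_int (coeff_fun (int (a i) - int (n i) - 1)) :: complex)"
    unfolding coeff_fun_of_int[symmetric] by (intro arg_cong[of _ _ coeff_fun]) simp
  then show ?thesis
    using coeff_eulerian_top[of "n i" "shifted_roots i" N, OF _ z] assms n_le[of i]
    by (simp add: length_shifted_roots prod_shifted_roots del: of_nat_Suc)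
qed

lemma degree_eulerian_shifted:
  assumes "i \<le> r"
  shows "degree (eulerian (shifted_roots i)) = k - n i"
proof (rule antisym)
  show "degree (eulerian (shifted_roots i)) \<le> k - n i"
    using assms by (intro degree_le) (auto simp: coeff_eulerian_shifted_top)
  show "k - n i \<le> degree (eulerian (shifted_roots i))"
    using assms n_le[OF assms] coeff_fun_int_nonzero[OF assms]
    by (intro le_degree) (simp add: coeff_eulerian_shifted_top)
qed

lemma u_nonzero: "u i \<noteq> 0"
  using poly_u_1[of i] by auto

lemma degree_u: "i \<le> r \<Longrightarrow> degree (u i) = a i + k - n i"
  using u_nonzero[of i] n_le[of i] by (auto simp: u_def degree_mult_eq degree_monom_eq degree_eulerian_shifted)

lemma degree_u_less: "i < j \<Longrightarrow> j \<le> r \<Longrightarrow> degree (u i) < degree (u j)"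
  using gap_less[of i j] n_le[of i] n_le[of j] by (simp add: degree_u)

lemma coeff_u_a: "i \<le> r \<Longrightarrow> coeff (u i) (a i) \<noteq> 0"
  using coeff_fun_int_nonzero[of i "int (a i)"] coeff_fun_of_int[of "int (a i)", where 'b = complex]
    prod_shifted_roots[of 0 i]
  by (simp add: coeff_u coeff_eulerian)

definition eulerian_space :: "complex poly set" where
  "eulerian_space = cpoly.span (u ` {..r})"

lemma u_inj: "inj_on u {..r}" and u_independent: "cpoly.independent (u ` {..r})"
proof -
  have "\<forall>i\<le>r. c i = 0" if "(\<Sum>i\<le>r. smult (c i) (u i)) = 0" for c
    using lincomb_top_degree[where R = r and u = u and c = c, OF degree_u_less u_nonzero] that by blast
  then show "inj_on u {..r}" "cpoly.independent (u ` {..r})"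
    using independent_family[where R = r and u = u] by blast+
qed

lemma eulerian_space_cases:
  assumes "w \<in> eulerian_space"
  obtains c where "w = (\<Sum>i\<le>r. smult (c i) (u i))"
  using span_family[OF u_inj] assms unfolding eulerian_space_def by blast

lemma u_in_eulerian_space: "i \<le> r \<Longrightarrow> u i \<in> eulerian_space"
  unfolding eulerian_space_def by (intro cpoly.span_base) auto

lemma dim_eulerian_space: "cpoly.dim eulerian_space = r + 1"
  unfolding eulerian_space_def cpoly.dim_span_eq_card_independent[OF u_independent] card_image[OF u_inj] by simp

text \<open>
  A combination whose coefficients add up to zero annihilates the common tail of the series, so that
  a polynomial remains besides the factor \<open>(1 - x)\<^bsup>k+1\<^esup>\<close>.
\<close>
lemma lincomb_vanishing_at_1:
  assumes "(\<Sum>i\<le>r. c i) = 0"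
  obtains q where "(\<Sum>i\<le>r. smult (c i) (u i)) = [:1, -1:] ^ Suc k * q"
    "\<And>N. coeff q N = (\<Sum>i\<le>r. if N < a i then 0 else c i) * coeff_fun (of_nat N)"
proof -
  let ?f = "\<lambda>N. (\<Sum>i\<le>r. if N < a i then 0 else c i) * coeff_fun (of_nat N)"
  define q where "q = (\<Sum>N<a r. monom (?f N) N)"
  have z: "?f N = 0" if "\<not> N < a r" for N
  proof -
    have "(\<Sum>i\<le>r. if N < a i then 0 else c i) = (\<Sum>i\<le>r. c i)"
    proof (intro sum.cong refl)
      fix i assume "i \<in> {..r}"
      then have "a i \<le> N" using that a_mono[of i r] by simp
      then show "(if N < a i then 0 else c i) = c i" by simp
    qed
    then show ?thesis using assms by simp
  qed
  have q: "coeff q N = ?f N" for N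
    using z[of N] by (cases "N < a r") (simp_all add: q_def coeff_sum)
  have X: "fps_of_poly [:1, -1:] = (1 - fps_X :: complex fps)"
    by (simp add: fps_of_poly_pCons)
  have "fps_of_poly (\<Sum>i\<le>r. smult (c i) (u i)) =
      (1 - fps_X) ^ Suc k * (\<Sum>i\<le>r. fps_const (c i) * Abs_fps (\<lambda>N. if N < a i then 0 else coeff_fun (of_nat N)))"
    unfolding fps_of_poly_sum fps_of_poly_smult fps_of_poly_u sum_distrib_left
    by (intro sum.cong) (simp_all add: mult_ac)
  also have "(\<Sum>i\<le>r. fps_const (c i) * Abs_fps (\<lambda>N. if N < a i then 0 else coeff_fun (of_nat N))) = fps_of_poly q"
    by (rule fps_ext) (auto simp: fps_sum_nth q sum_distrib_right intro!: sum.cong)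
  finally have "(\<Sum>i\<le>r. smult (c i) (u i)) = [:1, -1:] ^ Suc k * q"
    unfolding fps_of_poly_eq_iff[symmetric] fps_of_poly_mult fps_of_poly_power X .
  then show thesis using q by (rule that)
qed

text \<open>
  On the block between \<open>a\<^sub>s\<close> and \<open>a\<^bsub>s+1\<^esub>\<close> the factors of \<open>g\<close> that belong to exponents up to \<open>a\<^sub>s\<close> are
  positive.  For a larger exponent \<open>a\<close> the factors \<open>N - a + 1, N - a + 2, \<dots>\<close> are consecutive
  integers that start at or below \<open>0\<close>: they are all negative unless one of them is zero.
\<close>
lemma coeff_fun_sign:
  assumes "s < r" "a s \<le> N" "N < a (Suc s)"
  shows "0 \<le> (\<Prod>s'\<in>{s<..r}. (-1) ^ n s') * coeff_fun (int N)"
proof -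
  have "{..r} = {..s} \<union> {s<..r}" using assms(1) by auto
  moreover have "{..s} \<inter> {s<..r} = {}" by auto
  ultimately have "coeff_fun (int N) = (\<Prod>s'\<le>s. \<Prod>t=1..n s'. int N - int (a s') + int t) *
      (\<Prod>s'\<in>{s<..r}. \<Prod>t=1..n s'. int N - int (a s') + int t)"
    unfolding coeff_fun_def by (simp add: prod.union_disjoint)
  then have "(\<Prod>s'\<in>{s<..r}. (-1) ^ n s') * coeff_fun (int N) =
      (\<Prod>s'\<le>s. \<Prod>t=1..n s'. int N - int (a s') + int t) *
      (\<Prod>s'\<in>{s<..r}. (-1) ^ n s' * (\<Prod>t=1..n s'. int N - int (a s') + int t))"
    by (simp add: prod.distrib)
  also have "\<dots> \<ge> 0"
  proof (rule mult_nonneg_nonneg; rule prod_nonneg)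
    fix s' assume "s' \<in> {..s}"
    then have "a s' \<le> N" using a_mono[of s' s] assms by auto
    then show "0 \<le> (\<Prod>t=1..n s'. int N - int (a s') + int t)"
      by (intro prod_nonneg) auto
  next
    fix s' assume s': "s' \<in> {s<..r}"
    then have N: "N < a s'" using a_mono[of "Suc s" s'] assms by auto
    have "(-1) ^ n s' * (\<Prod>t=1..n s'. int N - int (a s') + int t) =
        (\<Prod>t=1..n s'. (-1) * (int N - int (a s') + int t))"
      by (subst prod.distrib) simp
    also have "\<dots> = (\<Prod>t=1..n s'. int (a s') - int N - int t)"
      by (intro prod.cong) auto
    also have "\<dots> \<ge> 0"
    proof (cases "a s' - N \<le> n s'")
      case True
      then have "(\<Prod>t=1..n s'. int (a s') - int N - int t) = 0"
        using N by (intro prod_zero bexI[of _ "a s' - N"]) auto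
      then show ?thesis by (metis order_refl)
    next
      case False
      then show ?thesis by (intro prod_nonneg) auto
    qed
    finally show "0 \<le> (-1) ^ n s' * (\<Prod>t=1..n s'. int N - int (a s') + int t)" .
  qed
  finally show ?thesis .
qed

lemma order_1_eulerian_space:
  assumes "w \<in> eulerian_space" "w \<noteq> 0"
  shows "order 1 w \<in> {0} \<union> {k + 1..k + r}"
proof (cases "poly w 1 = 0")
  case True
  obtain c where w: "w = (\<Sum>i\<le>r. smult (c i) (u i))" using assms(1) by (rule eulerian_space_cases)
  have "poly w 1 = (\<Sum>i\<le>r. c i) * fact k"
    by (simp add: w poly_sum poly_u_1 sum_distrib_right)
  then have "(\<Sum>i\<le>r. c i) = 0" using True by simp
  from lincomb_vanishing_at_1[OF this] obtain q where
    q: "w = [:1, -1:] ^ Suc k * q" "\<And>N. coeff q N = (\<Sum>i\<le>r. if N < a i then 0 else c i) * coeff_fun (of_nat N)"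
    unfolding w by blast
  have "[:1, -1:] = smult (-1) [:-1, 1 :: complex:]" by simp
  then have wq: "w = smult ((-1) ^ Suc k) ([:-1, 1:] ^ Suc k * q)"
    unfolding q(1) by (metis smult_power mult_smult_left)
  have ord: "order 1 w = Suc k + order 1 q"
  proof -
    have "[:-1, 1:] ^ Suc k * q \<noteq> 0" using assms(2) wq by (metis smult_0_right)
    moreover have "order 1 w = order 1 ([:-1, 1:] ^ Suc k * q)"
      unfolding wq by (rule order_smult) simp
    ultimately show ?thesis by (simp add: order_mult order_power_n_n del: power_Suc)
  qed
  have "order 1 q < r"
  proof (rule ccontr)
    assume "\<not> order 1 q < r"
    then have dvd: "[:-1, 1:] ^ r dvd q" by (simp add: order_divides)
    \<comment> \<open>The sign of \<open>g\<close> on the block \<open>s\<close> is moved into the block constant, leaving the weight \<open>\<bar>g\<bar>\<close>.\<close>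
    define \<epsilon> :: "nat \<Rightarrow> int" where "\<epsilon> s = (\<Prod>s'\<in>{s<..r}. (-1) ^ n s')" for s
    have eps: "\<epsilon> s * \<epsilon> s = 1" for s
      by (simp add: \<epsilon>_def flip: prod.distrib power_mult_distrib)
    have "q = 0"
    proof (rule block_constant_signs_root_1[where \<gamma> = "\<lambda>s. (\<Sum>i\<le>s. c i) * of_int (\<epsilon> s)" and b = a
            and w = "\<lambda>N. real_of_int (\<bar>coeff_fun (int N)\<bar>)", OF _ _ _ dvd])
      fix s N assume s: "s < r" "a s \<le> N" "N < a (Suc s)"
      have i: "N < a i \<longleftrightarrow> s < i" if "i \<le> r" for i
        using that s a_mono[of i s] a_mono[of "Suc s" i] by (cases "i \<le> s") auto
      have "(\<Sum>i\<le>r. if N < a i then 0 else c i) = (\<Sum>i\<le>s. c i)"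
        using s(1) by (intro sum.mono_neutral_cong_right) (auto simp: i)
      moreover have "coeff_fun (int N) = \<epsilon> s * \<bar>coeff_fun (int N)\<bar>"
      proof -
        have "\<epsilon> s * coeff_fun (int N) \<ge> 0" using coeff_fun_sign[OF s] by (simp add: \<epsilon>_def)
        then have "\<epsilon> s * coeff_fun (int N) = \<bar>\<epsilon> s\<bar> * \<bar>coeff_fun (int N)\<bar>" by (simp flip: abs_mult)
        moreover have "\<bar>\<epsilon> s\<bar> = 1" by (simp add: \<epsilon>_def abs_prod power_abs)
        ultimately show ?thesis using eps[of s] by (metis mult.assoc mult_1)
      qed
      then have "coeff_fun (of_nat N) = complex_of_int (\<epsilon> s * \<bar>coeff_fun (int N)\<bar>)"
        using coeff_fun_of_int[of "int N", where 'b = complex] by simp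
      ultimately show "coeff q N = (\<Sum>i\<le>s. c i) * of_int (\<epsilon> s) * of_real (real_of_int \<bar>coeff_fun (int N)\<bar>) \<and>
          0 \<le> real_of_int \<bar>coeff_fun (int N)\<bar>"
        unfolding q(2) by (simp del: of_int_abs)
    next
      fix N assume "N < a 0 \<or> a r \<le> N"
      then have "(\<Sum>i\<le>r. if N < a i then 0 else c i) = (\<Sum>i\<le>r. if N < a 0 then 0 else c i)"
      proof (intro sum.cong refl)
        fix i assume "i \<in> {..r}"
        then have "a i \<le> a r" "a 0 \<le> a i" "a 0 \<le> a r" using a_mono by auto
        then show "(if N < a i then 0 else c i) = (if N < a 0 then 0 else c i)"
          using \<open>N < a 0 \<or> a r \<le> N\<close> by auto
      qed
      then show "coeff q N = 0"
        unfolding q(2) using \<open>(\<Sum>i\<le>r. c i) = 0\<close> by (cases "N < a 0") auto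
    qed (use a_mono in auto)
    then show False using assms(2) q(1) by simp
  qed
  then show ?thesis using ord by auto
next
  case False
  then show ?thesis by (simp add: order_0I)
qed

definition prescribed_exponents :: "complex poly set \<Rightarrow> bool" where
  "prescribed_exponents V \<longleftrightarrow> cpoly.subspace V \<and> cpoly.dim V = r + 1 \<and>
     degree ` (V - {0}) = (\<lambda>i. a i + k - n i) ` {..r} \<and>
     order 0 ` (V - {0}) = a ` {..r} \<and>
     order 1 ` (V - {0}) = {0} \<union> {k + 1..k + r}"

text \<open>
  The orders at \<open>1\<close> lie in a set with \<open>r + 1\<close> elements by \<open>order_1_eulerian_space\<close>, and a space of dimension
  \<open>r + 1\<close> has at least that many orders; so all of them occur.
\<close>
lemma prescribed_exponents_eulerian_space: "prescribed_exponents eulerian_space"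
proof -
  have sub: "cpoly.subspace eulerian_space" unfolding eulerian_space_def by (rule cpoly.subspace_span)
  have nz: "\<exists>i0\<le>r. c i0 \<noteq> 0" if "(\<Sum>i\<le>r. smult (c i) (u i)) \<noteq> 0" for c
    using that by (metis (no_types, lifting) smult_0_left sum.neutral atMost_iff)
  have deg: "degree ` (eulerian_space - {0}) = (\<lambda>i. a i + k - n i) ` {..r}"
  proof (intro antisym subsetI)
    fix d assume "d \<in> degree ` (eulerian_space - {0})"
    then obtain c where c: "d = degree (\<Sum>i\<le>r. smult (c i) (u i))" "(\<Sum>i\<le>r. smult (c i) (u i)) \<noteq> 0"
      by (auto elim!: eulerian_space_cases)
    then obtain i where "i \<le> r" "d = degree (u i)"
      using lincomb_top_degree[where R = r and u = u and c = c, OF degree_u_less u_nonzero] nz[OF c(2)] by blast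
    then show "d \<in> (\<lambda>i. a i + k - n i) ` {..r}" using degree_u by auto
  next
    fix d assume "d \<in> (\<lambda>i. a i + k - n i) ` {..r}"
    then obtain i where i: "i \<le> r" "d = degree (u i)" using degree_u by auto
    then show "d \<in> degree ` (eulerian_space - {0})" using u_in_eulerian_space[OF i(1)] u_nonzero[of i] by blast
  qed
  have ord0: "order 0 ` (eulerian_space - {0}) = a ` {..r}"
  proof (intro antisym subsetI)
    fix d assume "d \<in> order 0 ` (eulerian_space - {0})"
    then obtain c where c: "d = order 0 (\<Sum>i\<le>r. smult (c i) (u i))" "(\<Sum>i\<le>r. smult (c i) (u i)) \<noteq> 0"
      by (auto elim!: eulerian_space_cases)
    have "\<exists>i\<le>r. order 0 (\<Sum>i\<le>r. smult (c i) (u i)) = a i"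
    proof -
      obtain i0 where "i0 \<le> r" "c i0 \<noteq> 0" using nz[OF c(2)] by blast
      then show ?thesis
        using add_lessD1[OF gap_less] coeff_u_a by (rule_tac lincomb_order_0) (simp_all add: coeff_u)
    qed
    then show "d \<in> a ` {..r}" using c(1) by auto
  next
    fix d assume "d \<in> a ` {..r}"
    then obtain i where i: "i \<le> r" "d = a i" by auto
    then have "order 0 (u i) = d" using coeff_u_a by (intro order_0_eqI) (auto simp: coeff_u)
    then show "d \<in> order 0 ` (eulerian_space - {0})" using u_in_eulerian_space[OF i(1)] u_nonzero by force
  qed
  have sub1: "order 1 ` (eulerian_space - {0}) \<subseteq> {0} \<union> {k + 1..k + r}" by (intro image_subsetI order_1_eulerian_space) auto
  have "r + 1 \<le> card (order 1 ` (eulerian_space - {0}))"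
    using dim_le_card_orders[OF sub finite_subset[OF sub1]] dim_eulerian_space by simp
  moreover have "card ({0} \<union> {k + 1..k + r}) \<le> r + 1"
    using card_Un_le[of "{0}" "{k + 1..k + r}"] by simp
  ultimately have "order 1 ` (eulerian_space - {0}) = {0} \<union> {k + 1..k + r}"
    using sub1 by (intro card_seteq) auto
  then show ?thesis
    unfolding prescribed_exponents_def using sub dim_eulerian_space deg ord0 by blast
qed

end

section \<open>Uniqueness of the space with given exponents\<close>

context exponent_data
begin

text \<open>
  This carries the uniqueness.  In the proof, \<open>G\<close> is the polynomial that would describe the tail of
  the series \<open>k! d\<^sub>i / (1 - x)\<^bsup>k+1\<^esup>\<close>.  The congruences make it independent of \<open>i\<close>, the supports
  give it \<open>n\<^sub>i\<close> roots just below each \<open>a\<^sub>i\<close>, and \<open>d\<^sub>0(1) = 0\<close> lowers its degree below the number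
  \<open>k\<close> of these roots.
\<close>
lemma vanishing_family:
  fixes d :: "nat \<Rightarrow> complex poly"
  assumes supp: "\<And>i N. i \<le> r \<Longrightarrow> coeff (d i) N \<noteq> 0 \<Longrightarrow> a i \<le> N \<and> N + n i \<le> a i + k"
    and cong: "\<And>i. i \<le> r \<Longrightarrow> [:-1, 1:] ^ Suc k dvd d i - d 0"
    and at_1: "poly (d 0) 1 = 0"
    and "i \<le> r"
  shows "d i = 0"
proof -
  \<comment> \<open>\<open>B y\<close> and \<open>Q j\<close> are \<open>(y - j + 1) \<cdots> (y - j + k)\<close> as a polynomial in \<open>j\<close> and in \<open>y\<close>, respectively.\<close>
  define B :: "complex \<Rightarrow> complex poly" where "B y = (\<Prod>t=1..k. [:y + of_nat t, -1:])" for y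
  define Q :: "nat \<Rightarrow> complex poly" where "Q j = (\<Prod>t=1..k. [:of_nat t - of_nat j, 1:])" for j
  define G where "G = (\<Sum>j\<le>degree (d 0). smult (coeff (d 0) j) (Q j))"
  have B: "poly (B y) (of_nat j) = (\<Prod>t=1..k. y + of_nat t - of_nat j)" for y j
    by (simp add: B_def poly_prod)
  have QB: "poly (Q j) y = poly (B y) (of_nat j)" for j y
    unfolding B by (simp add: Q_def poly_prod algebra_simps)
  have "degree (B y) \<le> k" for y
    unfolding B_def by (rule order_trans[OF degree_prod_sum_le]) auto
  then have "moment (d i - d 0) (B y) = 0" if "i \<le> r" for i y
    using cong[OF that] by (rule_tac moment_eq_0[of "Suc k"]) (simp_all only: less_Suc_eq_le)
  then have G: "moment (d i) (B y) = poly G y" if "i \<le> r" for i y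
    using that moment_diff[of "d i" "d 0" "B y"] by (simp add: G_def poly_sum QB moment_def)
  have G_root: "poly G (of_nat (a i) - of_nat t) = 0" if "i \<le> r" "t \<in> {1..n i}" for i t
  proof -
    have "moment (d i) (B (of_nat (a i) - of_nat t)) = 0"
      unfolding moment_def
    proof (intro sum.neutral ballI)
      fix j
      show "coeff (d i) j * poly (B (of_nat (a i) - of_nat t)) (of_nat j) = 0"
      proof (cases "coeff (d i) j = 0")
        case False
        then have j: "a i \<le> j" "j + n i \<le> a i + k" using supp that by blast+
        then have "of_nat (a i) - of_nat t + of_nat (t + j - a i) - of_nat j = (0::complex)"
          using that by (simp add: of_nat_diff)
        moreover have "t + j - a i \<in> {1..k}" using j that by auto
        ultimately show ?thesis unfolding B by (auto intro!: prod_zero)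
      qed simp
    qed
    then show ?thesis using G[OF that(1)] by simp
  qed
  have Qk: "degree (Q j) = k" "coeff (Q j) k = 1" for j
  proof -
    show 1: "degree (Q j) = k"
      unfolding Q_def by (subst degree_prod_eq_sum_degree) auto
    have "lead_coeff (Q j) = 1" unfolding Q_def lead_coeff_prod by simp
    then show "coeff (Q j) k = 1" using 1 by simp
  qed
  have "coeff G k = poly (d 0) 1"
    by (simp add: G_def coeff_sum Qk poly_altdef)
  then have Gk: "coeff G k = 0" using at_1 by simp
  have "degree G \<le> k"
    unfolding G_def by (intro degree_sum_le) (auto intro!: order_trans[OF degree_smult_le] simp: Qk)
  have "G = 0"
  proof (rule ccontr)
    assume nz: "G \<noteq> 0"
    then have "degree G \<noteq> k" using Gk by (metis leading_coeff_0_iff)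
    then have deg: "degree G < k" using \<open>degree G \<le> k\<close> by simp
    define S where "S = (SIGMA i:{..r}. {1..n i})"
    define f :: "nat \<times> nat \<Rightarrow> complex" where "f = (\<lambda>(i, t). of_nat (a i) - of_nat t)"
    have "inj_on f S"
    proof (rule inj_onI, clarify)
      fix i t i' t' assume S: "(i, t) \<in> S" "(i', t') \<in> S" and eq: "f (i, t) = f (i', t')"
      have "complex_of_int (int (a i) - int t) = of_int (int (a i') - int t')"
        using eq by (simp add: f_def)
      then have "int (a i) - int t = int (a i') - int t'" by (simp only: of_int_eq_iff)
      then show "i = i' \<and> t = t'"
        using S gap_less[of i i'] gap_less[of i' i] unfolding S_def
        by (cases i i' rule: linorder_cases) auto
    qed
    then have "card (f ` S) = card S" by (rule card_image)
    also have "\<dots> = k" unfolding S_def sum_n by simp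
    finally have "k = card (f ` S)" ..
    also have "\<dots> \<le> card {y. poly G y = 0}"
      using G_root poly_roots_finite[OF nz] by (intro card_mono) (auto simp: S_def f_def)
    also have "\<dots> \<le> degree G" using nz by (rule card_poly_roots_bound)
    finally show False using deg by simp
  qed
  show ?thesis
  proof (rule ccontr)
    assume "d i \<noteq> 0"
    then have ex: "coeff (d i) (degree (d i)) \<noteq> 0" by simp
    \<comment> \<open>At \<open>y = j0\<close> only the lowest term of \<open>d i\<close> survives, because its support has length at most \<open>k\<close>.\<close>
    define j0 where "j0 = (LEAST j. coeff (d i) j \<noteq> 0)"
    have j0: "coeff (d i) j0 \<noteq> 0" unfolding j0_def using ex by (rule LeastI)
    have least: "j0 \<le> j" if "coeff (d i) j \<noteq> 0" for j
      unfolding j0_def using that by (rule Least_le)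
    have "coeff (d i) j * poly (B (of_nat j0)) (of_nat j) =
        (if j = j0 then coeff (d i) j0 * fact k else 0)" for j
    proof (cases "coeff (d i) j = 0 \<or> j = j0")
      case True
      then show ?thesis using j0 by (auto simp: B fact_prod)
    next
      case False
      then have "j - j0 \<in> {1..k}" "j0 \<le> j"
        using least[of j] supp[OF \<open>i \<le> r\<close>, of j] supp[OF \<open>i \<le> r\<close>, of j0] j0 by auto
      then have "poly (B (of_nat j0)) (of_nat j) = 0"
        unfolding B by (intro prod_zero bexI[of _ "j - j0"]) (auto simp: of_nat_diff)
      then show ?thesis using False by simp
    qed
    then have "moment (d i) (B (of_nat j0)) = coeff (d i) j0 * fact k"
      using le_degree[OF j0] by (simp add: moment_def)
    then show False using G[OF \<open>i \<le> r\<close>] j0 \<open>G = 0\<close> by simp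
  qed
qed

lemma prescribed_exponents_dvd:
  assumes "prescribed_exponents V" "p \<in> V" "poly p 1 = 0"
  shows "[:-1, 1:] ^ Suc k dvd p"
proof (cases "p = 0")
  case False
  then have "order 1 p \<in> order 1 ` (V - {0})" using assms by blast
  then have "order 1 p \<in> {0} \<union> {k + 1..k + r}" using assms(1) unfolding prescribed_exponents_def by blast
  moreover have "order 1 p \<noteq> 0" using False assms(3) by (simp add: order_eq_0_iff)
  ultimately have "Suc k \<le> order 1 p" by auto
  then show ?thesis by (simp only: order_divides) simp
qed simp

text \<open>
  The elements of degree at most \<open>a\<^sub>i + k - n\<^sub>i\<close> form a space of dimension at least \<open>i + 1\<close>, so they
  have at least \<open>i + 1\<close> orders at \<open>0\<close>, one of which is \<open>a\<^sub>i\<close> or larger.  Such an element cannot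
  vanish at \<open>1\<close>: it would be divisible by \<open>(x - 1)\<^bsup>k+1\<^esup>\<close>, and the quotient would have
  degree less than \<open>a\<^sub>i\<close> but the same order at \<open>0\<close>.
\<close>
lemma prescribed_exponents_obtain:
  assumes V: "prescribed_exponents V" and i: "i \<le> r"
  obtains p where "p \<in> V" "poly p 1 = 1"
    "\<And>N. coeff p N \<noteq> 0 \<Longrightarrow> a i \<le> N \<and> N + n i \<le> a i + k"
proof -
  have sub: "cpoly.subspace V" using V by (simp add: prescribed_exponents_def)
  have "\<exists>p. p \<in> V \<and> p \<noteq> 0 \<and> degree p = a s + k - n s" if "s \<le> r" for s
  proof -
    have "a s + k - n s \<in> degree ` (V - {0})" using V that unfolding prescribed_exponents_def by auto
    then show ?thesis by auto
  qed
  then obtain z where z: "\<And>s. s \<le> r \<Longrightarrow> z s \<in> V \<and> z s \<noteq> 0 \<and> degree (z s) = a s + k - n s" by metis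
  have degz: "degree (z s) < degree (z s')" if "s < s'" "s' \<le> r" for s s'
    using that z[of s] z[of s'] degree_u[of s] degree_u[of s'] degree_u_less[of s s'] by simp
  have top: "\<exists>s\<le>i. (\<Sum>s\<le>i. smult (c s) (z s)) \<noteq> 0 \<and> degree (\<Sum>s\<le>i. smult (c s) (z s)) = degree (z s)"
    if "s0 \<le> i" "c s0 \<noteq> 0" for c s0
    using that i z degz by (intro lincomb_top_degree) auto
  then have "\<forall>s\<le>i. c s = 0" if "(\<Sum>s\<le>i. smult (c s) (z s)) = 0" for c
    using that by blast
  then have inj: "inj_on z {..i}" and ind: "cpoly.independent (z ` {..i})"
    using independent_family[where R = i and u = z] by blast+
  define U where "U = cpoly.span (z ` {..i})"
  have UV: "U \<subseteq> V" unfolding U_def using z i sub by (intro cpoly.span_minimal) auto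
  have subU: "cpoly.subspace U" unfolding U_def by (rule cpoly.subspace_span)
  have dimU: "cpoly.dim U = i + 1"
    unfolding U_def cpoly.dim_span_eq_card_independent[OF ind] card_image[OF inj] by simp
  have ordU: "order 0 ` (U - {0}) \<subseteq> a ` {..r}" using UV V unfolding prescribed_exponents_def by blast
  \<comment> \<open>Otherwise the space \<open>U\<close> of dimension \<open>i + 1\<close> would have at most \<open>i\<close> orders.\<close>
  have "\<not> order 0 ` (U - {0}) \<subseteq> a ` {..<i}"
  proof
    assume "order 0 ` (U - {0}) \<subseteq> a ` {..<i}"
    then have "card (order 0 ` (U - {0})) \<le> i"
      by (metis card_image_le card_lessThan card_mono finite_imageI finite_lessThan order_trans)
    moreover have "i + 1 \<le> card (order 0 ` (U - {0}))"
      using dim_le_card_orders[OF subU finite_subset[OF ordU]] dimU by simp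
    ultimately show False by simp
  qed
  then obtain p where p: "p \<in> U" "p \<noteq> 0" "order 0 p \<notin> a ` {..<i}" by blast
  then obtain s where s: "s \<le> r" "order 0 p = a s" using ordU by blast
  then have "i \<le> s" using p(3) by (metis imageI lessThan_iff not_le)
  then have low: "a i \<le> order 0 p" using s a_mono by simp
  have high: "degree p \<le> a i + k - n i"
  proof -
    obtain c where c: "p = (\<Sum>s\<le>i. smult (c s) (z s))" using span_family[OF inj] p(1) unfolding U_def by blast
    have "degree (z s) \<le> a i + k - n i" if "s \<le> i" for s
      using degz[of s i] z[OF i] that i by (cases "s = i") auto
    then show ?thesis unfolding c by (intro degree_sum_le) (auto intro: order_trans[OF degree_smult_le])
  qed
  have supp: "a i \<le> N \<and> N + n i \<le> a i + k" if "coeff p N \<noteq> 0" for N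
  proof
    have "monom 1 (a i) dvd p" using low p(2) by (simp add: monom_1_dvd_iff)
    then show "a i \<le> N" using that by (metis monom_1_dvd_iff' not_le)
    show "N + n i \<le> a i + k" using le_degree[OF that] high n_le[OF i] by linarith
  qed
  have p1: "poly p 1 \<noteq> 0"
  proof
    assume "poly p 1 = 0"
    then have "[:-1, 1:] ^ Suc k dvd p" using prescribed_exponents_dvd[OF V] p(1) UV by blast
    then obtain q where q: "p = [:-1, 1:] ^ Suc k * q" by (auto simp: dvd_def)
    then have qnz: "q \<noteq> 0" using p(2) by auto
    have "order 0 ([:-1, 1 :: complex:] ^ Suc k) = 0" by (intro order_0I) (simp add: poly_power)
    then have "order 0 p = order 0 q" using p(2) unfolding q by (subst order_mult) auto
    then have "a i \<le> degree q" using low order_degree[OF qnz, of 0] by simp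
    moreover have "degree p = Suc k + degree q"
      unfolding q using qnz by (subst degree_mult_eq) (auto simp: degree_linear_power simp del: power_Suc)
    ultimately show False using high n_le[OF i] by simp
  qed
  show thesis
  proof (rule that[of "smult (1 / poly p 1) p"])
    show "smult (1 / poly p 1) p \<in> V" using p(1) UV sub by (auto intro: cpoly.subspace_scale)
  qed (use p1 supp in auto)
qed

lemma coeff_u_support:
  assumes "i \<le> r" "coeff (u i) N \<noteq> 0"
  shows "a i \<le> N \<and> N + n i \<le> a i + k"
  using assms le_degree[OF assms(2)] n_le[OF assms(1)] by (auto simp: degree_u coeff_u split: if_splits)

text \<open>
  The normalised elements of \<open>V\<close> from \<open>prescribed_exponents_obtain\<close> and the normalised \<open>u\<^sub>i\<close> differ by a family as in
  \<open>vanishing_family\<close>; hence \<open>V\<close> contains the \<open>u\<^sub>i\<close>.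
\<close>
lemma prescribed_exponents_unique:
  assumes V: "prescribed_exponents V"
  shows "V = eulerian_space"
proof -
  have sub: "cpoly.subspace V" and dimV: "cpoly.dim V = r + 1" using V by (simp_all add: prescribed_exponents_def)
  have subW: "cpoly.subspace eulerian_space" using prescribed_exponents_eulerian_space by (simp add: prescribed_exponents_def)
  have "\<exists>p. i \<le> r \<longrightarrow> p \<in> V \<and> poly p 1 = 1 \<and> (\<forall>N. coeff p N \<noteq> 0 \<longrightarrow> a i \<le> N \<and> N + n i \<le> a i + k)" for i
    using prescribed_exponents_obtain[OF V] by metis
  then obtain p where p: "\<And>i. i \<le> r \<Longrightarrow> p i \<in> V" "\<And>i. i \<le> r \<Longrightarrow> poly (p i) 1 = 1"
    "\<And>i N. i \<le> r \<Longrightarrow> coeff (p i) N \<noteq> 0 \<Longrightarrow> a i \<le> N \<and> N + n i \<le> a i + k" by metis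
  define d where "d i = p i - smult (1 / fact k) (u i)" for i
  have "u i \<in> V" if i: "i \<le> r" for i
  proof -
    have "d i = 0"
    proof (rule vanishing_family)
      fix i N assume "i \<le> r" "coeff (d i) N \<noteq> 0"
      then have "coeff (p i) N \<noteq> 0 \<or> coeff (u i) N \<noteq> 0" by (auto simp: d_def)
      then show "a i \<le> N \<and> N + n i \<le> a i + k" using \<open>i \<le> r\<close> p(3) coeff_u_support by blast
    next
      fix i assume i: "i \<le> r"
      have "[:-1, 1:] ^ Suc k dvd p i - p 0"
        using i p sub by (intro prescribed_exponents_dvd[OF V]) (auto intro: cpoly.subspace_diff)
      moreover have "[:-1, 1:] ^ Suc k dvd u i - u 0"
        using i u_in_eulerian_space subW by (intro prescribed_exponents_dvd[OF prescribed_exponents_eulerian_space]) (auto intro: cpoly.subspace_diff simp: poly_u_1)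
      moreover have "d i - d 0 = (p i - p 0) - smult (1 / fact k) (u i - u 0)"
        by (simp add: d_def smult_diff_right)
      ultimately show "[:-1, 1:] ^ Suc k dvd d i - d 0"
        by (simp only: dvd_diff dvd_smult)
    qed (use i p in \<open>auto simp: d_def poly_u_1\<close>)
    then have "u i = smult (fact k) (p i)" by (simp add: d_def)
    then show ?thesis using p(1)[OF i] sub by (simp add: cpoly.subspace_scale)
  qed
  then have uV: "u ` {..r} \<subseteq> V" by auto
  obtain B where B: "u ` {..r} \<subseteq> B" "B \<subseteq> V" "cpoly.independent B" "V \<subseteq> cpoly.span B"
    using cpoly.maximal_independent_subset_extend[OF uV u_independent] by blast
  have "card B = r + 1" using cpoly.basis_card_eq_dim[OF B(2,4,3)] dimV by simp
  moreover have "card (u ` {..r}) = r + 1" using card_image[OF u_inj] by simp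
  moreover from \<open>card B = r + 1\<close> have "finite B" by (intro card_ge_0_finite) simp
  ultimately have "u ` {..r} = B" using B(1) by (intro card_subset_eq) auto
  then have "V \<subseteq> eulerian_space" using B(4) by (simp add: eulerian_space_def)
  moreover have "eulerian_space \<subseteq> V" unfolding eulerian_space_def using uV sub by (rule cpoly.span_minimal)
  ultimately show ?thesis by blast
qed

end

section \<open>Consistent parameters\<close>

text \<open>
  The number \<open>n\<^sub>s = l\<^sub>s - l\<^bsub>s+1\<^esub>\<close>, which is also the number of times that \<open>s\<close> occurs in an admissible
  sequence.
\<close>
definition drop_at :: "nat \<Rightarrow> (nat \<Rightarrow> nat) \<Rightarrow> nat \<Rightarrow> nat \<Rightarrow> nat" where
  "drop_at r l k s = lext r l k s - lext r l k (Suc s)"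

lemma int_drop_at:
  assumes "consistent r m l k" "s \<le> r"
  shows "int (drop_at r l k s) = int (lext r l k s) - int (lext r l k (Suc s))"
  using assms by (simp add: consistent_def drop_at_def of_nat_diff)

lemma consistent_exponent_data:
  assumes "consistent r m l k"
  shows "exponent_data r k (expo0 m) (drop_at r l k)"
proof
  fix s assume "s < r"
  then have "int (drop_at r l k (Suc s)) \<le> int (m (Suc s))"
    using assms int_drop_at[OF assms, of "Suc s"] by (auto simp: consistent_def)
  then have "drop_at r l k (Suc s) \<le> m (Suc s)" by simp
  then show "expo0 m s + drop_at r l k (Suc s) < expo0 m (Suc s)"
    by (simp add: expo0_def)
next
  have "int (\<Sum>s\<le>r. drop_at r l k s) = (\<Sum>s\<le>r. int (lext r l k s) - int (lext r l k (Suc s)))"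
    unfolding of_nat_sum by (intro sum.cong refl int_drop_at[OF assms]) auto
  also have "\<dots> = int (lext r l k 0) - int (lext r l k (Suc r))"
    by (rule sum_telescope)
  also have "\<dots> = int k" by (simp add: lext_def)
  finally show "k = (\<Sum>s\<le>r. drop_at r l k s)"
    by (simp only: of_nat_eq_iff)
qed

lemma Vspace_eq_eulerian_space:
  assumes c: "consistent r m l k"
  shows "Vspace r m l k = exponent_data.eulerian_space r (expo0 m) (drop_at r l k)"
proof -
  interpret exponent_data r k "expo0 m" "drop_at r l k"
    using c by (rule consistent_exponent_data)
  have e: "expo_inf r m l k i = int (expo0 m i + k - drop_at r l k i)" if "i \<le> r" for i
    using int_drop_at[OF c that] n_le[OF that] by (simp add: expo_inf_def expo0_def of_nat_diff)
  have "(\<lambda>p. int (degree p)) ` (V - {0}) = expo_inf r m l k ` {0..r} \<longleftrightarrow>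
      degree ` (V - {0}) = (\<lambda>i. expo0 m i + k - drop_at r l k i) ` {..r}" for V :: "complex poly set"
  proof -
    have "(\<lambda>p. int (degree p)) ` (V - {0}) = int ` degree ` (V - {0})"
      by (rule image_image[symmetric])
    moreover have "expo_inf r m l k ` {0..r} = int ` (\<lambda>i. expo0 m i + k - drop_at r l k i) ` {..r}"
      unfolding image_image atLeast0AtMost by (rule image_cong[OF refl], rule e) simp
    moreover have "inj int" by simp
    ultimately show ?thesis by (simp only: inj_image_eq_iff)
  qed
  then have eq: "has_exponents r m l k V \<longleftrightarrow> prescribed_exponents V" for V
    unfolding has_exponents_def prescribed_exponents_def by (simp only: atLeast0AtMost)
  show ?thesis
    unfolding Vspace_def eq by (rule the_equality, rule prescribed_exponents_eulerian_space, rule prescribed_exponents_unique)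
qed

section \<open>The operators in terms of coefficient sequences\<close>

text \<open>
  On numerators \<open>(1 - x)\<^bsup>t+1\<^esup> F\<close> the operator acts, up to sign, as \<open>x d/dx - (e - t - 1)\<close> on \<open>F\<close>,
  where \<open>e\<close> is the degree that it contains as a parameter; this is one step of \<open>eulerian\<close>.
\<close>
lemma Dop_monom_eulerian:
  assumes "length ss = t"
  shows "Dop r m i l t (monom 1 A * eulerian ss) =
    - (monom 1 A * eulerian ((of_int (expo_inf r m l t i) - of_nat t - 1 - of_nat A) # ss))"
proof -
  have "[:0, 1:] * pderiv (monom 1 A) = smult (of_nat A) (monom 1 A :: complex poly)"
    by (cases A) (simp_all add: pderiv_monom smult_monom flip: monom_Suc)
  then have d: "[:0, 1:] * pderiv (monom 1 A * eulerian ss) =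
      smult (of_nat A) (monom 1 A) * eulerian ss + monom 1 A * ([:0, 1:] * pderiv (eulerian ss))"
    unfolding pderiv_mult by (simp only: distrib_left mult.left_commute mult.commute add.commute)
  have D: "[:0, 1:] * [:-1, 1:] * pderiv (monom 1 A * eulerian ss) =
      [:-1, 1:] * ([:0, 1:] * pderiv (monom 1 A * eulerian ss))"
    by (simp only: mult_ac)
  have X: "[:1, -1:] = 1 - [:0, 1 :: complex:]" "[:-1, 1:] = [:0, 1 :: complex:] - 1"
    by (simp_all add: one_pCons)
  show ?thesis
    unfolding Dop_def D d eulerian.simps assms unfolding X
    by (simp add: algebra_simps smult_add_left smult_diff_left smult_add_right smult_diff_right del: mult_pCons_left mult_pCons_right)
qed

definition occurrences :: "(nat \<Rightarrow> nat) \<Rightarrow> nat \<Rightarrow> nat \<Rightarrow> nat" where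
  "occurrences j N s = card {t \<in> {1..N}. j t = s}"

lemma occurrences_Suc: "occurrences j (Suc N) s = occurrences j N s + (if j (Suc N) = s then 1 else 0)"
proof -
  have "{t \<in> {1..Suc N}. j t = s} = {t \<in> {1..N}. j t = s} \<union> (if j (Suc N) = s then {Suc N} else {})"
    by (auto simp: le_Suc_eq)
  then show ?thesis by (simp add: occurrences_def)
qed

text \<open>The sum of \<open>ones (j t) s\<close> counts the \<open>t\<close> with \<open>s \<le> j t\<close>.\<close>
lemma occurrences_eq_diff:
  assumes "\<forall>t\<in>{1..N}. j t \<le> r" "s \<le> r"
  shows "int (occurrences j N s) = int (lext r (\<lambda>s. \<Sum>t=1..N. ones (j t) s) N s)
    - int (lext r (\<lambda>s. \<Sum>t=1..N. ones (j t) s) N (Suc s))"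
  using assms(1)
proof (induction N)
  case 0
  show ?case by (simp add: occurrences_def lext_def)
next
  case (Suc N)
  then have "j (Suc N) \<le> r" by simp
  with Suc assms(2) show ?case
    by (auto simp: occurrences_Suc lext_def ones_def le_Suc_eq)
qed

lemma expo_inf_partial:
  assumes "\<forall>t\<in>{1..N}. j t \<le> r" "i \<le> r"
  shows "expo_inf r m (\<lambda>s. \<Sum>t=1..N. ones (j t) s) N i = int (expo0 m i) + int N - int (occurrences j N i)"
  using occurrences_eq_diff[OF assms] by (simp add: expo_inf_def expo0_def)

text \<open>
  When the index \<open>s\<close> is used for the \<open>c\<close>-th time, the new root is \<open>a\<^sub>s - c\<close>,
  translated by \<open>A\<close>.  Only the number of
  uses of each index therefore matters for the product.
\<close>
lemma Dcomp_eulerian: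
  assumes "\<forall>t\<in>{1..N}. j t \<le> r"
  shows "\<exists>ss. length ss = N \<and> Dcomp r m j N (monom 1 A) = smult ((-1) ^ N) (monom 1 A * eulerian ss) \<and>
    (\<forall>y. (\<Prod>\<sigma>\<leftarrow>ss. y - \<sigma>) =
      (\<Prod>s\<le>r. \<Prod>t=1..occurrences j N s. y + of_nat A - of_nat (expo0 m s) + of_nat t))"
  using assms
proof (induction N)
  case 0
  show ?case by (intro exI[of _ "[]"]) (simp add: occurrences_def)
next
  case (Suc N)
  then have le: "\<forall>t\<in>{1..N}. j t \<le> r" and jr: "j (Suc N) \<le> r" by auto
  obtain ss where ss: "length ss = N" "Dcomp r m j N (monom 1 A) = smult ((-1) ^ N) (monom 1 A * eulerian ss)"
    "\<And>y. (\<Prod>\<sigma>\<leftarrow>ss. y - \<sigma>) =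
      (\<Prod>s\<le>r. \<Prod>t=1..occurrences j N s. y + of_nat A - of_nat (expo0 m s) + of_nat t)"
    using Suc.IH[OF le] by blast
  define J where "J = j (Suc N)"
  define e where "e = expo_inf r m (\<lambda>s. \<Sum>t=1..N. ones (j t) s) N J"
  define \<sigma> :: complex where "\<sigma> = of_int e - of_nat N - 1 - of_nat A"
  have scale: "Dop r m J l N (smult c p) = smult c (Dop r m J l N p)" for l c p
    by (simp add: Dop_def pderiv_smult smult_diff_right algebra_simps)
  have D: "Dcomp r m j (Suc N) (monom 1 A) = smult ((-1) ^ Suc N) (monom 1 A * eulerian (\<sigma> # ss))"
    unfolding Dcomp.simps ss(2) J_def[symmetric] scale Dop_monom_eulerian[OF ss(1)] e_def[symmetric] \<sigma>_def[symmetric]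
    by simp
  have \<sigma>: "y - \<sigma> = y + of_nat A - of_nat (expo0 m J) + of_nat (occurrences j (Suc N) J)" for y
    unfolding \<sigma>_def e_def J_def expo_inf_partial[OF le jr] by (simp add: occurrences_Suc)
  have P: "(\<Prod>\<sigma>\<leftarrow>\<sigma> # ss. y - \<sigma>) =
      (\<Prod>s\<le>r. \<Prod>t=1..occurrences j (Suc N) s. y + of_nat A - of_nat (expo0 m s) + of_nat t)" for y
  proof -
    let ?f = "\<lambda>s t. y + of_nat A - of_nat (expo0 m s) + of_nat t"
    have "(\<Prod>s\<le>r. \<Prod>t=1..occurrences j (Suc N) s. ?f s t) =
      (\<Prod>s\<le>r. (if s = J then y - \<sigma> else 1) * (\<Prod>t=1..occurrences j N s. ?f s t))"
      unfolding \<sigma> by (intro prod.cong) (auto simp: occurrences_Suc J_def)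
    also have "\<dots> = (y - \<sigma>) * (\<Prod>s\<le>r. \<Prod>t=1..occurrences j N s. ?f s t)"
      using jr by (simp add: prod.distrib J_def)
    finally show ?thesis by (simp add: ss(3))
  qed
  show ?case using D P ss(1) by (intro exI[of _ "\<sigma> # ss"]) simp
qed

lemma Dcomp_eq_u:
  assumes c: "consistent r m l k" and j: "admissible_seq r l k j"
  shows "Dcomp r m j k (monom 1 (expo0 m i)) = smult ((-1) ^ k) (exponent_data.u r (expo0 m) (drop_at r l k) i)"
proof -
  interpret exponent_data r k "expo0 m" "drop_at r l k"
    using c by (rule consistent_exponent_data)
  have le: "\<forall>t\<in>{1..k}. j t \<le> r" and sum: "\<And>s. s \<in> {1..r} \<Longrightarrow> (\<Sum>t=1..k. ones (j t) s) = l s"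
    using j by (auto simp: admissible_seq_def)
  have lext: "lext r (\<lambda>s. \<Sum>t=1..k. ones (j t) s) k s = lext r l k s" for s
    using sum[of s] by (auto simp: lext_def)
  have occ: "occurrences j k s = drop_at r l k s" if "s \<le> r" for s
    using occurrences_eq_diff[OF le that] int_drop_at[OF c that] by (simp only: lext)
  obtain ss where ss: "length ss = k"
    "Dcomp r m j k (monom 1 (expo0 m i)) = smult ((-1) ^ k) (monom 1 (expo0 m i) * eulerian ss)"
    "\<And>y. (\<Prod>\<sigma>\<leftarrow>ss. y - \<sigma>) =
      (\<Prod>s\<le>r. \<Prod>t=1..occurrences j k s. y + of_nat (expo0 m i) - of_nat (expo0 m s) + of_nat t)"
    using Dcomp_eulerian[OF le] by blast
  have "eulerian ss = eulerian (shifted_roots i)"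
    by (rule eulerian_cong) (simp_all add: ss(1,3) length_shifted_roots prod_shifted_roots coeff_fun_def occ)
  then show ?thesis by (simp add: ss(2) u_def)
qed

section \<open>Rational dependence on the parameters\<close>

lemma monomial_eval_superset:
  fixes x :: "nat \<Rightarrow> rat"
  assumes "finite K" "Poly_Mapping.keys t \<subseteq> K"
  shows "(\<Prod>s\<in>Poly_Mapping.keys t. x s ^ Poly_Mapping.lookup t s) = (\<Prod>s\<in>K. x s ^ Poly_Mapping.lookup t s)"
  using assms by (intro prod.mono_neutral_left) (auto simp: in_keys_iff)

lemma monomial_eval_add:
  fixes x :: "nat \<Rightarrow> rat" and s t :: "nat \<Rightarrow>\<^sub>0 nat"
  shows "(\<Prod>i\<in>Poly_Mapping.keys (s + t). x i ^ Poly_Mapping.lookup (s + t) i) =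
    (\<Prod>i\<in>Poly_Mapping.keys s. x i ^ Poly_Mapping.lookup s i) *
    (\<Prod>i\<in>Poly_Mapping.keys t. x i ^ Poly_Mapping.lookup t i)"
proof -
  define K where "K = Poly_Mapping.keys s \<union> Poly_Mapping.keys t"
  have K: "finite K" "Poly_Mapping.keys s \<subseteq> K" "Poly_Mapping.keys t \<subseteq> K" "Poly_Mapping.keys (s + t) \<subseteq> K"
    using Poly_Mapping.keys_add[of s t] by (auto simp: K_def)
  show ?thesis
    unfolding
      monomial_eval_superset[OF K(1,2)] monomial_eval_superset[OF K(1,3)] monomial_eval_superset[OF K(1,4)]
    by (simp add: lookup_add power_add prod.distrib)
qed

lemma mpoly_eval_superset:
  assumes "finite K" "Poly_Mapping.keys P \<subseteq> K"
  shows "mpoly_eval P x =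
    (\<Sum>t\<in>K. Poly_Mapping.lookup P t * (\<Prod>s\<in>Poly_Mapping.keys t. x s ^ Poly_Mapping.lookup t s))"
  unfolding mpoly_eval_def using assms by (intro sum.mono_neutral_left) (auto simp: in_keys_iff)

lemma mpoly_eval_add: "mpoly_eval (P + Q) x = mpoly_eval P x + mpoly_eval Q x"
proof -
  define K where "K = Poly_Mapping.keys P \<union> Poly_Mapping.keys Q"
  have K: "finite K" "Poly_Mapping.keys P \<subseteq> K" "Poly_Mapping.keys Q \<subseteq> K" "Poly_Mapping.keys (P + Q) \<subseteq> K"
    using Poly_Mapping.keys_add[of P Q] by (auto simp: K_def)
  show ?thesis
    unfolding mpoly_eval_superset[OF K(1,2)] mpoly_eval_superset[OF K(1,3)] mpoly_eval_superset[OF K(1,4)]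
    by (simp add: lookup_add algebra_simps sum.distrib)
qed

lemma mpoly_eval_0: "mpoly_eval 0 x = 0"
  by (simp add: mpoly_eval_def)

lemma mpoly_eval_sum: "mpoly_eval (\<Sum>i\<in>I. f i) x = (\<Sum>i\<in>I. mpoly_eval (f i) x)"
  by (induction I rule: infinite_finite_induct) (simp_all add: mpoly_eval_add mpoly_eval_0)

lemma mpoly_eval_single:
  "mpoly_eval (Poly_Mapping.single t c) x = c * (\<Prod>s\<in>Poly_Mapping.keys t. x s ^ Poly_Mapping.lookup t s)"
  by (subst mpoly_eval_superset[where K = "{t}"]) auto

lemma mpoly_sum_monomials:
  fixes P :: "(nat \<Rightarrow>\<^sub>0 nat) \<Rightarrow>\<^sub>0 rat"
  shows "P = (\<Sum>t\<in>Poly_Mapping.keys P. Poly_Mapping.single t (Poly_Mapping.lookup P t))"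
  by (rule poly_mapping_eqI) (auto simp: lookup_sum lookup_single when_def in_keys_iff)

lemma mpoly_eval_mult: "mpoly_eval (P * Q) x = mpoly_eval P x * mpoly_eval Q x"
proof -
  have "P * Q = (\<Sum>s\<in>Poly_Mapping.keys P. \<Sum>t\<in>Poly_Mapping.keys Q.
      Poly_Mapping.single (s + t) (Poly_Mapping.lookup P s * Poly_Mapping.lookup Q t))"
    by (subst mpoly_sum_monomials[of P], subst mpoly_sum_monomials[of Q])
       (simp add: sum_product mult_single)
  then show ?thesis
    by (simp only: mpoly_eval_sum mpoly_eval_single monomial_eval_add)
       (simp add: mpoly_eval_def sum_product mult_ac)
qed

text \<open>
  The argument \<open>m\<close> ranges over all tuples, consistent or not, so that numerators and denominators
  can be treated separately and no domain has to be carried along.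
\<close>
definition polynomial_function :: "nat \<Rightarrow> ((nat \<Rightarrow> nat) \<Rightarrow> rat) \<Rightarrow> bool" where
  "polynomial_function r f \<longleftrightarrow>
     (\<exists>P. mpoly_vars P \<subseteq> {1..r} \<and> (\<forall>m. mpoly_eval P (\<lambda>s. of_nat (m s)) = f m))"

lemma polynomial_function_const: "polynomial_function r (\<lambda>_. c)"
  unfolding polynomial_function_def
  by (intro exI[of _ "Poly_Mapping.single 0 c"]) (auto simp: mpoly_vars_def mpoly_eval_single)

lemma polynomial_function_var:
  assumes "s \<in> {1..r}"
  shows "polynomial_function r (\<lambda>m. of_nat (m s))"
  unfolding polynomial_function_def
  by (intro exI[of _ "Poly_Mapping.single (Poly_Mapping.single s 1) 1"])
     (use assms in \<open>auto simp: mpoly_vars_def mpoly_eval_single\<close>)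

lemma polynomial_function_add:
  assumes "polynomial_function r f" "polynomial_function r g"
  shows "polynomial_function r (\<lambda>m. f m + g m)"
proof -
  obtain P Q where P: "mpoly_vars P \<subseteq> {1..r}" "\<And>m. mpoly_eval P (\<lambda>s. of_nat (m s)) = f m"
    and Q: "mpoly_vars Q \<subseteq> {1..r}" "\<And>m. mpoly_eval Q (\<lambda>s. of_nat (m s)) = g m"
    using assms unfolding polynomial_function_def by blast
  have "mpoly_vars (P + Q) \<subseteq> {1..r}"
    using P(1) Q(1) Poly_Mapping.keys_add[of P Q] unfolding mpoly_vars_def by blast
  then show ?thesis
    unfolding polynomial_function_def using P Q by (intro exI[of _ "P + Q"]) (simp add: mpoly_eval_add)
qed

lemma polynomial_function_mult:
  assumes "polynomial_function r f" "polynomial_function r g"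
  shows "polynomial_function r (\<lambda>m. f m * g m)"
proof -
  obtain P Q where P: "mpoly_vars P \<subseteq> {1..r}" "\<And>m. mpoly_eval P (\<lambda>s. of_nat (m s)) = f m"
    and Q: "mpoly_vars Q \<subseteq> {1..r}" "\<And>m. mpoly_eval Q (\<lambda>s. of_nat (m s)) = g m"
    using assms unfolding polynomial_function_def by blast
  have "mpoly_vars (P * Q) \<subseteq> {1..r}"
  proof
    fix i assume "i \<in> mpoly_vars (P * Q)"
    then obtain t where "t \<in> Poly_Mapping.keys (P * Q)" "i \<in> Poly_Mapping.keys t"
      by (auto simp: mpoly_vars_def)
    moreover from this(1) obtain p q where "t = p + q" "p \<in> Poly_Mapping.keys P" "q \<in> Poly_Mapping.keys Q"
      using Poly_Mapping.keys_mult[of P Q] by blast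
    ultimately have "i \<in> mpoly_vars P \<union> mpoly_vars Q"
      using Poly_Mapping.keys_add[of p q] by (auto simp: mpoly_vars_def)
    then show "i \<in> {1..r}" using P(1) Q(1) by blast
  qed
  then show ?thesis
    unfolding polynomial_function_def using P Q by (intro exI[of _ "P * Q"]) (simp add: mpoly_eval_mult)
qed

lemma polynomial_function_sum:
  assumes "\<And>i. i \<in> I \<Longrightarrow> polynomial_function r (f i)"
  shows "polynomial_function r (\<lambda>m. \<Sum>i\<in>I. f i m)"
  using assms
  by (induction I rule: infinite_finite_induct)
     (auto intro: polynomial_function_add polynomial_function_const)

lemma polynomial_function_prod:
  assumes "\<And>i. i \<in> I \<Longrightarrow> polynomial_function r (f i)"
  shows "polynomial_function r (\<lambda>m. \<Prod>i\<in>I. f i m)"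
  using assms
  by (induction I rule: infinite_finite_induct)
     (auto intro: polynomial_function_mult polynomial_function_const)

lemma polynomial_function_expo0:
  assumes "i \<le> r"
  shows "polynomial_function r (\<lambda>m. of_nat (expo0 m i))"
  unfolding expo0_def of_nat_add of_nat_sum
  using assms
  by (intro polynomial_function_add polynomial_function_sum polynomial_function_const polynomial_function_var) auto

text \<open>
  Here \<open>g i z\<close> is the coefficient function at \<open>a\<^sub>i + z\<close>, read over the rationals; for fixed \<open>z\<close> it
  is a polynomial in \<open>m\<close>, because the number of its factors depends on \<open>l\<close> and \<open>k\<close> only.
\<close>
lemma coeff_eulerian_rational:
  assumes c: "consistent r m l k"
  defines "g \<equiv> \<lambda>i (z :: rat). \<Prod>s\<le>r. \<Prod>t=1..drop_at r l k s.
    z + of_nat (expo0 m i) - of_nat (expo0 m s) + of_nat t"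
  shows "coeff (eulerian (exponent_data.shifted_roots r (expo0 m) (drop_at r l k) i)) N =
      of_rat (\<Sum>j\<le>N. (-1) ^ j * of_nat (Suc k choose j) * g i (of_nat N - of_nat j))" (is ?coeff)
    and "i \<le> r \<Longrightarrow> lead_coeff (eulerian (exponent_data.shifted_roots r (expo0 m) (drop_at r l k) i)) =
      of_rat ((-1) ^ k * g i (- of_nat (Suc (drop_at r l k i))))" (is "_ \<Longrightarrow> ?lead")
proof -
  interpret exponent_data r k "expo0 m" "drop_at r l k"
    using c by (rule consistent_exponent_data)
  have g: "of_rat (g i z) = coeff_fun (of_rat z + of_nat (expo0 m i) :: complex)" for i z
    by (simp add: g_def coeff_fun_def of_rat_prod of_rat_add of_rat_diff)
  show ?coeff
    by (simp add: coeff_eulerian length_shifted_roots prod_shifted_roots of_rat_sum of_rat_mult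
        of_rat_power of_rat_minus of_rat_diff g)
  show ?lead if i: "i \<le> r"
  proof -
    have "g i (- of_nat (Suc (drop_at r l k i))) = of_int (coeff_fun (int (expo0 m i) - int (drop_at r l k i) - 1))"
      unfolding coeff_fun_of_int[symmetric] by (simp add: g_def coeff_fun_def algebra_simps)
    then show ?thesis
      using i n_le[OF i] by (simp add: degree_eulerian_shifted coeff_eulerian_shifted_top of_rat_mult of_rat_power of_rat_minus)
  qed
qed

lemma rational_coefficients:
  assumes i: "i \<le> r"
  shows "rational_function_on r {m. consistent r m l k}
    (\<lambda>m. let E = eulerian (exponent_data.shifted_roots r (expo0 m) (drop_at r l k) i)
         in coeff E N / lead_coeff E)"
proof -
  define g where "g = (\<lambda>m (z :: rat). \<Prod>s\<le>r. \<Prod>t=1..drop_at r l k s.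
    z + of_nat (expo0 m i) - of_nat (expo0 m s) + of_nat t)"
  define num where "num m = (\<Sum>j\<le>N. (-1) ^ j * of_nat (Suc k choose j) * g m (of_nat N - of_nat j))" for m
  define den where "den m = (-1) ^ k * g m (- of_nat (Suc (drop_at r l k i)))" for m
  have "polynomial_function r (\<lambda>m. g m z)" for z
  proof -
    have "polynomial_function r (\<lambda>m. (z + of_nat (expo0 m i)) + (-1) * of_nat (expo0 m s) + of_nat t)"
      if "s \<le> r" for s t
      using i that
      by (intro polynomial_function_add polynomial_function_mult polynomial_function_expo0 polynomial_function_const)
    then show ?thesis
      unfolding g_def by (intro polynomial_function_prod) simp
  qed
  then have "polynomial_function r num" "polynomial_function r den"
    unfolding num_def den_def
    by (intro polynomial_function_sum polynomial_function_mult polynomial_function_const; simp)+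
  then obtain P Q where PQ: "mpoly_vars P \<subseteq> {1..r}" "\<And>m. mpoly_eval P (\<lambda>s. of_nat (m s)) = num m"
      "mpoly_vars Q \<subseteq> {1..r}" "\<And>m. mpoly_eval Q (\<lambda>s. of_nat (m s)) = den m"
    unfolding polynomial_function_def by blast
  have "den m \<noteq> 0 \<and> (let E = eulerian (exponent_data.shifted_roots r (expo0 m) (drop_at r l k) i)
      in coeff E N / lead_coeff E) = of_rat (num m / den m)" if c: "consistent r m l k" for m
  proof -
    interpret exponent_data r k "expo0 m" "drop_at r l k"
      using c by (rule consistent_exponent_data)
    have "eulerian (shifted_roots i) \<noteq> 0" using u_nonzero[of i] by (auto simp: u_def)
    then have "lead_coeff (eulerian (shifted_roots i)) \<noteq> 0" by simp
    moreover have "lead_coeff (eulerian (shifted_roots i)) = of_rat (den m)"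
      using coeff_eulerian_rational(2)[OF c i] by (simp add: den_def g_def)
    moreover have "coeff (eulerian (shifted_roots i)) N = of_rat (num m)"
      using coeff_eulerian_rational(1)[OF c, of i N] by (simp add: num_def g_def)
    ultimately show ?thesis by (auto simp: Let_def of_rat_divide)
  qed
  then show ?thesis
    unfolding rational_function_on_def using PQ by (intro exI[of _ P] exI[of _ Q]) auto
qed

section \<open>Monic basis of the space\<close>

lemma (in exponent_data) scaled_basis:
  assumes "\<And>i. i \<le> r \<Longrightarrow> \<mu> i \<noteq> 0"
  shows "is_basis_family r (\<lambda>i. smult (\<mu> i) (u i)) eulerian_space"
proof -
  let ?b = "\<lambda>i. smult (\<mu> i) (u i)"
  have ind: "\<forall>i\<le>r. c i = 0" if "(\<Sum>i\<le>r. smult (c i) (?b i)) = 0" for c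
  proof (rule ccontr)
    assume "\<not> (\<forall>i\<le>r. c i = 0)"
    then obtain i0 where "i0 \<le> r" "c i0 * \<mu> i0 \<noteq> 0" using assms by auto
    then show False
      using lincomb_top_degree[where R = r and u = u and c = "\<lambda>i. c i * \<mu> i", OF degree_u_less u_nonzero] that
      by auto
  qed
  have "?b ` {..r} \<subseteq> eulerian_space"
    using u_in_eulerian_space unfolding eulerian_space_def by (auto intro: cpoly.span_scale)
  then have "cpoly.span (?b ` {..r}) \<subseteq> eulerian_space"
    unfolding eulerian_space_def by (intro cpoly.span_minimal cpoly.subspace_span)
  moreover have "u ` {..r} \<subseteq> cpoly.span (?b ` {..r})"
  proof clarify
    fix i assume "i \<le> r"
    then have "smult (1 / \<mu> i) (?b i) \<in> cpoly.span (?b ` {..r})"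
      by (intro cpoly.span_scale[OF cpoly.span_base]) auto
    then show "u i \<in> cpoly.span (?b ` {..r})" using assms[OF \<open>i \<le> r\<close>] by simp
  qed
  then have "eulerian_space \<subseteq> cpoly.span (?b ` {..r})"
    unfolding eulerian_space_def by (intro cpoly.span_minimal cpoly.subspace_span)
  ultimately show ?thesis
    using independent_family[where R = r and u = ?b] ind
    unfolding is_basis_family_def atLeast0AtMost by blast
qed

theorem lemma4p4:
  fixes r k :: nat and l :: "nat \<Rightarrow> nat"
  assumes "r \<ge> 1"
  shows "\<exists>v :: (nat \<Rightarrow> nat) \<Rightarrow> nat \<Rightarrow> complex poly.
    (\<forall>m. consistent r m l k \<longrightarrow>
       is_basis_family r (\<lambda>i. v m i * monom 1 (expo0 m i)) (Vspace r m l k) \<and>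
       (\<forall>i\<le>r. lead_coeff (v m i) = 1 \<and>
          int (degree (v m i)) = int k - int (lext r l k i) + int (lext r l k (i + 1))) \<and>
       (\<forall>j. admissible_seq r l k j \<longrightarrow>
          (\<forall>i\<le>r. \<exists>c. c \<noteq> 0 \<and>
             monom 1 (expo0 m i) * v m i = smult c (Dcomp r m j k (monom 1 (expo0 m i)))))) \<and>
    (\<forall>i\<le>r. \<forall>n. rational_function_on r {m. consistent r m l k} (\<lambda>m. coeff (v m i) n))"
proof -
  define E where "E m i = eulerian (exponent_data.shifted_roots r (expo0 m) (drop_at r l k) i)" for m i
  define v where "v m i = smult (1 / lead_coeff (E m i)) (E m i)" for m i
  show ?thesis
  proof (intro exI[of _ v] conjI allI impI)
    fix m assume c: "consistent r m l k"
    interpret exponent_data r k "expo0 m" "drop_at r l k"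
      using c by (rule consistent_exponent_data)
    have E: "E m i = eulerian (shifted_roots i)" for i by (simp add: E_def)
    have lead: "lead_coeff (E m i) \<noteq> 0" for i
      using u_nonzero[of i] by (auto simp: u_def E)
    have vu: "v m i * monom 1 (expo0 m i) = smult (1 / lead_coeff (E m i)) (u i)" for i
      by (simp add: v_def u_def E mult.commute)
    show "is_basis_family r (\<lambda>i. v m i * monom 1 (expo0 m i)) (Vspace r m l k)"
      unfolding vu Vspace_eq_eulerian_space[OF c] by (rule scaled_basis) (use lead in simp)
    show "lead_coeff (v m i) = 1" for i
      using lead[of i] by (simp add: v_def)
    show "int (degree (v m i)) = int k - int (lext r l k i) + int (lext r l k (i + 1))" if "i \<le> r" for i
      using that lead[of i] n_le[OF that] int_drop_at[OF c that] degree_eulerian_shifted[OF that]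
      by (simp add: v_def E of_nat_diff)
    fix j i assume j: "admissible_seq r l k j" and i: "i \<le> r"
    have "monom 1 (expo0 m i) * v m i =
        smult ((-1) ^ k / lead_coeff (E m i)) (Dcomp r m j k (monom 1 (expo0 m i)))"
      using vu[of i] by (simp add: Dcomp_eq_u[OF c j] mult.commute flip: power_mult_distrib)
    then show "\<exists>c. c \<noteq> 0 \<and> monom 1 (expo0 m i) * v m i = smult c (Dcomp r m j k (monom 1 (expo0 m i)))"
      using lead[of i] by (intro exI[of _ "(-1) ^ k / lead_coeff (E m i)"]) simp
  next
    fix i n assume "i \<le> r"
    then show "rational_function_on r {m. consistent r m l k} (\<lambda>m. coeff (v m i) n)"
      using rational_coefficients[of i r l k n] by (simp add: v_def E_def Let_def)
  qed
qed

end
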